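(* Assume that $\mathcal G_n\to\mathcal G_{\rm hom}$ locally uniformly in $(0,L)$. If $l\in(0,L)$ and $\mathcal G_{\rm hom}(l)\ne0$ then $$G^c_{\rm eff}(l)=\max\{G^c_A,G^c_B\}.$$
   Context: Geometry. $L,H>0$, $\Omega=(0,L)\times(-H,H)$, $K_l=[0,l]\times\{0\}$ for $l\in(0,L]$; $\partial_D\Omega=\{0\}\times((-H,0)\cup(0,H))\ \cup\ \{L\}\times(-H,H)$; $g\in H^{1/2}(\partial_D\Omega)$ (on each of the three open segments); $\mathcal U_l=\{u\in H^1(\Omega\setminus K_l):u=g\text{ on }\partial_D\Omega\}$. Vertical layers. $\lambda\in(0,1)$, $n\in\mathbb N\setminus\{0\}$; $l_{n,k}=kL/n$ ($k=0,\dots,n$), $l_{n,k+\lambda}=(k+\lambda)L/n$ ($k=0,\dots,n-1$); $\Lambda_n$ is the set of all these points. $\boldsymbol C_A=\mathrm{diag}(\mu_{A,1},\mu_{A,2})$, $\boldsymbol C_B=\mathrm{diag}(\mu_{B,1},\mu_{B,2})$ with positive entries; toughnesses $G^c_A,G^c_B>0$. $\boldsymbol C_n(x)=\boldsymbol C_A$ if $x_1\in(l_{n,k},l_{n,k+\lambda})$, $\boldsymbol C_n(x)=\boldsymbol C_B$ if $x_1\in(l_{n,k+\lambda},l_{n,k+1})$. $G^c_n(l)=G^c_A$ for $l\in[l_{n,k},l_{n,k+\lambda})$, $G^c_n(l)=G^c_B$ for $l\in[l_{n,k+\lambda},l_{n,k+1})$, $G^c_n(L)=G^c_A$. Energy and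 energy release. $\mathcal E_n(l)=\min\{\tfrac12\int_{\Omega\setminus K_l}\nabla u\,\boldsymbol C_n\nabla u^T\,dx:u\in\mathcal U_l\}$, which is of class $C^1$ in $(0,L)\setminus\Lambda_n$. $\mathcal G_n(l)=-\mathcal E_n'(l)$ for $l\in(0,L)\setminus\Lambda_n$, $\mathcal G_n(l)=\liminf_{s\to l^+}\mathcal G_n(s)$ for $l\in\Lambda_n\setminus\{L\}$ (possibly $+\infty$), $\mathcal G_n(L)=0$. Homogenized quantities. $\boldsymbol C_{\rm hom}=\mathrm{diag}(\mu_{{\rm hom},1},\mu_{{\rm hom},2})$ with $1/\mu_{{\rm hom},1}=\lambda/\mu_{A,1}+(1-\lambda)/\mu_{B,1}$, $\mu_{{\rm hom},2}=\lambda\mu_{A,2}+(1-\lambda)\mu_{B,2}$. $\mathcal E_{\rm hom}(l)=\min\{\tfrac12\int_{\Omega\setminus K_l}\nabla u\,\boldsymbol C_{\rm hom}\nabla u^T\,dx:u\in\mathcal U_l\}$, of class $C^1(0,L)$; $\mathcal G_{\rm hom}(l)=-\mathcal E_{\rm hom}'(l)$ for $l\in(0,L)$. Effective toughness. For $l\in(0,L)$ with $\mathcal G_{\rm hom}(l)\ne0$: $G^c_{\rm eff}(l)=\mathcal G_{\rm hom}(l)/\gamma(l)$, where $\gamma(l)=\inf\{\liminf_{n\to\infty}\mathcal G_n(l_n)/G^c_n(l_n):l_n\in[0,L],\ l_n\to l\}$ is the $\Gamma$-liminf of $\mathcal G_n/G^c_n$ at $l$ (and $G^c_{\rm eff}(l)=+\infty$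 if $\gamma(l)=0$). *)

theory Defs
  imports "HOL-Analysis.Analysis"
begin

section \<open>Sobolev spaces and traces in the plane\<close>

text \<open>
  Functions in \<open>L\<^sup>2\<close> are represented by Borel functions (every class has such a representative);
  all conditions and quantities below depend only on the class modulo null sets.
\<close>

definition L2_on :: "'a::euclidean_space set \<Rightarrow> ('a \<Rightarrow> real) \<Rightarrow> bool" where
  "L2_on U f \<longleftrightarrow> set_borel_measurable lborel U f \<and> set_integrable lborel U (\<lambda>x. (f x)\<^sup>2)"

primrec C_k :: "nat \<Rightarrow> (real \<times> real \<Rightarrow> real) \<Rightarrow> bool" where
  "C_k 0 f \<longleftrightarrow> continuous_on UNIV f"
| "C_k (Suc k) f \<longleftrightarrow> (\<exists>f1 f2.
     (\<forall>x. (f has_derivative (\<lambda>h. f1 x * fst h + f2 x * snd h)) (at x)) \<and> C_k k f1 \<and> C_k k f2)"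

definition test_function :: "(real \<times> real) set \<Rightarrow> (real \<times> real \<Rightarrow> real) \<Rightarrow> bool" where
  "test_function U \<phi> \<longleftrightarrow> (\<forall>k. C_k k \<phi>) \<and>
     compact (closure {x. \<phi> x \<noteq> 0}) \<and> closure {x. \<phi> x \<noteq> 0} \<subseteq> U"

text \<open>\<open>u \<in> H\<^sup>1(U)\<close> with weak gradient \<open>v\<close>; here \<open>U\<close> is open.\<close>

definition H1_with_gradient ::
    "(real \<times> real) set \<Rightarrow> (real \<times> real \<Rightarrow> real) \<Rightarrow> (real \<times> real \<Rightarrow> real \<times> real) \<Rightarrow> bool" where
  "H1_with_gradient U u v \<longleftrightarrow>
     L2_on U u \<and> L2_on U (\<lambda>x. fst (v x)) \<and> L2_on U (\<lambda>x. snd (v x)) \<and>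
     (\<forall>\<phi>. test_function U \<phi> \<longrightarrow>
        (LINT x:U|lborel. u x * frechet_derivative \<phi> (at x) (1, 0))
          = - (LINT x:U|lborel. fst (v x) * \<phi> x) \<and>
        (LINT x:U|lborel. u x * frechet_derivative \<phi> (at x) (0, 1))
          = - (LINT x:U|lborel. snd (v x) * \<phi> x))"

definition H1 :: "(real \<times> real) set \<Rightarrow> (real \<times> real \<Rightarrow> real) set" where
  "H1 U = {u. \<exists>v. H1_with_gradient U u v}"

text \<open>
  \<open>H\<^sup>1\<^sup>/\<^sup>2(J)\<close> for an open interval \<open>J\<close>, through the Gagliardo seminorm. The division by zero on the
  diagonal is harmless, the diagonal being a null set.
\<close>

definition H_half :: "real set \<Rightarrow> (real \<Rightarrow> real) \<Rightarrow> bool" where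
  "H_half J h \<longleftrightarrow> L2_on J h \<and>
     set_integrable lborel (J \<times> J) (\<lambda>(s, t). (h s - h t)\<^sup>2 / (s - t)\<^sup>2)"

text \<open>
  For an open rectangle \<open>R\<close> having \<open>{a} \<times> J\<close> as one of its open vertical sides: the trace on that
  side of \<open>u \<in> H\<^sup>1(R)\<close> is \<open>h\<close>. The trace operator is the continuous map from \<open>H\<^sup>1(R)\<close> to \<open>L\<^sup>2\<close> of the
  side which extends the restriction of the functions in \<open>H\<^sup>1(R)\<close> that are continuous on the closure
  of \<open>R\<close>; these are dense in \<open>H\<^sup>1(R)\<close>, so the trace is the limit of the restrictions along any
  approximating sequence.
\<close>

definition has_trace ::
    "(real \<times> real) set \<Rightarrow> real \<Rightarrow> real set \<Rightarrow> (real \<times> real \<Rightarrow> real) \<Rightarrow> (real \<Rightarrow> real) \<Rightarrow> bool" where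
  "has_trace R a J u h \<longleftrightarrow> L2_on J h \<and>
     (\<exists>v w z. H1_with_gradient R u v \<and>
        (\<forall>k::nat. H1_with_gradient R (w k) (z k) \<and> continuous_on (closure R) (w k)) \<and>
        (\<lambda>k. LINT x:R|lborel. (w k x - u x)\<^sup>2 + (norm (z k x - v x))\<^sup>2) \<longlonglongrightarrow> 0 \<and>
        (\<lambda>k. LINT t:J|lborel. (w k (a, t) - h t)\<^sup>2) \<longlonglongrightarrow> 0)"


section \<open>The cracked domain and its elastic energy\<close>

definition Omega :: "real \<Rightarrow> real \<Rightarrow> (real \<times> real) set" where
  "Omega L H = {0<..<L} \<times> {-H<..<H}"

definition crack :: "real \<Rightarrow> (real \<times> real) set" where
  "crack l = {0..l} \<times> {0}"

definition boundary_datum :: "real \<Rightarrow> real \<Rightarrow> (real \<times> real \<Rightarrow> real) \<Rightarrow> bool" where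
  "boundary_datum L H g \<longleftrightarrow>
     H_half {-H<..<0} (\<lambda>t. g (0, t)) \<and> H_half {0<..<H} (\<lambda>t. g (0, t)) \<and>
     H_half {-H<..<H} (\<lambda>t. g (L, t))"

text \<open>
  The boundary condition is imposed through the traces from the upper and lower halves of the
  domain. Neither half meets the crack, and together their vertical sides cover the Dirichlet
  boundary up to the point \<open>(L, 0)\<close>.
\<close>

definition admissible ::
    "real \<Rightarrow> real \<Rightarrow> (real \<times> real \<Rightarrow> real) \<Rightarrow> real \<Rightarrow> (real \<times> real \<Rightarrow> real) set" where
  "admissible L H g l = {u \<in> H1 (Omega L H - crack l).
     (\<forall>a\<in>{0, L}.
        has_trace ({0<..<L} \<times> {0<..<H}) a {0<..<H} u (\<lambda>t. g (a, t)) \<and>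
        has_trace ({0<..<L} \<times> {-H<..<0}) a {-H<..<0} u (\<lambda>t. g (a, t)))}"

text \<open>
  A diagonal stiffness matrix is given by the pair of its diagonal entries. The infimum is a minimum;
  the value of the integral does not depend on the choice of the weak gradient \<open>v\<close> of \<open>u\<close>.
\<close>

definition elastic_energy ::
    "real \<Rightarrow> real \<Rightarrow> (real \<times> real \<Rightarrow> real) \<Rightarrow> (real \<times> real \<Rightarrow> real \<times> real) \<Rightarrow> real \<Rightarrow> real" where
  "elastic_energy L H g C l =
     Inf {1/2 * (LINT x:(Omega L H - crack l)|lborel.
                   fst (C x) * (fst (v x))\<^sup>2 + snd (C x) * (snd (v x))\<^sup>2) | u v.
          u \<in> admissible L H g l \<and> H1_with_gradient (Omega L H - crack l) u v}"


section \<open>Vertical layers\<close>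

definition layer_point :: "real \<Rightarrow> nat \<Rightarrow> real \<Rightarrow> real" where
  "layer_point L n s = s * L / real n"

definition interfaces :: "real \<Rightarrow> real \<Rightarrow> nat \<Rightarrow> real set" where
  "interfaces L lam n =
     {layer_point L n (real k) | k. k \<le> n} \<union> {layer_point L n (real k + lam) | k. k < n}"

text \<open>On the interfaces, which form a null set, the value of the stiffness is irrelevant.\<close>

definition layered_stiffness ::
    "real \<Rightarrow> real \<Rightarrow> real \<times> real \<Rightarrow> real \<times> real \<Rightarrow> nat \<Rightarrow> real \<times> real \<Rightarrow> real \<times> real" where
  "layered_stiffness L lam CA CB n x =
     (if \<exists>k<n. layer_point L n (real k) < fst x \<and> fst x < layer_point L n (real k + lam)
      then CA else CB)"

definition layered_toughness ::
    "real \<Rightarrow> real \<Rightarrow> real \<Rightarrow> real \<Rightarrow> nat \<Rightarrow> real \<Rightarrow> real" where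
  "layered_toughness L lam GcA GcB n l =
     (if l = L \<or> (\<exists>k<n. layer_point L n (real k) \<le> l \<and> l < layer_point L n (real k + lam))
      then GcA else GcB)"

definition layered_energy ::
    "real \<Rightarrow> real \<Rightarrow> (real \<times> real \<Rightarrow> real) \<Rightarrow> real \<Rightarrow> real \<times> real \<Rightarrow> real \<times> real \<Rightarrow> nat \<Rightarrow> real \<Rightarrow> real"
  where
  "layered_energy L H g lam CA CB n = elastic_energy L H g (layered_stiffness L lam CA CB n)"

definition layered_release ::
    "real \<Rightarrow> real \<Rightarrow> (real \<times> real \<Rightarrow> real) \<Rightarrow> real \<Rightarrow> real \<times> real \<Rightarrow> real \<times> real \<Rightarrow> nat \<Rightarrow> real \<Rightarrow> ereal"
  where
  "layered_release L H g lam CA CB n l =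
     (if l = L then 0
      else if l \<in> interfaces L lam n
      then Liminf (at_right l) (\<lambda>s. ereal (- deriv (layered_energy L H g lam CA CB n) s))
      else ereal (- deriv (layered_energy L H g lam CA CB n) l))"


section \<open>Homogenized quantities and effective toughness\<close>

definition homogenized_stiffness :: "real \<Rightarrow> real \<times> real \<Rightarrow> real \<times> real \<Rightarrow> real \<times> real" where
  "homogenized_stiffness lam CA CB =
     (1 / (lam / fst CA + (1 - lam) / fst CB), lam * snd CA + (1 - lam) * snd CB)"

definition homogenized_energy ::
    "real \<Rightarrow> real \<Rightarrow> (real \<times> real \<Rightarrow> real) \<Rightarrow> real \<Rightarrow> real \<times> real \<Rightarrow> real \<times> real \<Rightarrow> real \<Rightarrow> real" where
  "homogenized_energy L H g lam CA CB = elastic_energy L H g (\<lambda>x. homogenized_stiffness lam CA CB)"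

definition homogenized_release ::
    "real \<Rightarrow> real \<Rightarrow> (real \<times> real \<Rightarrow> real) \<Rightarrow> real \<Rightarrow> real \<times> real \<Rightarrow> real \<times> real \<Rightarrow> real \<Rightarrow> real" where
  "homogenized_release L H g lam CA CB l = - deriv (homogenized_energy L H g lam CA CB) l"

definition Gamma_liminf :: "real set \<Rightarrow> (nat \<Rightarrow> real \<Rightarrow> ereal) \<Rightarrow> real \<Rightarrow> ereal" where
  "Gamma_liminf D F l =
     (INF s\<in>{s. (\<forall>n. s n \<in> D) \<and> s \<longlonglongrightarrow> l}. liminf (\<lambda>n. F n (s n)))"

definition release_toughness_liminf ::
    "real \<Rightarrow> real \<Rightarrow> (real \<times> real \<Rightarrow> real) \<Rightarrow> real \<Rightarrow> real \<times> real \<Rightarrow> real \<times> real \<Rightarrow> real \<Rightarrow> real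
     \<Rightarrow> real \<Rightarrow> ereal" where
  "release_toughness_liminf L H g lam CA CB GcA GcB l =
     Gamma_liminf {0..L}
       (\<lambda>n s. layered_release L H g lam CA CB n s / ereal (layered_toughness L lam GcA GcB n s)) l"

definition effective_toughness ::
    "real \<Rightarrow> real \<Rightarrow> (real \<times> real \<Rightarrow> real) \<Rightarrow> real \<Rightarrow> real \<times> real \<Rightarrow> real \<times> real \<Rightarrow> real \<Rightarrow> real
     \<Rightarrow> real \<Rightarrow> ereal" where
  "effective_toughness L H g lam CA CB GcA GcB l =
     (if release_toughness_liminf L H g lam CA CB GcA GcB l = 0 then \<infinity>
      else ereal (homogenized_release L H g lam CA CB l)
             / release_toughness_liminf L H g lam CA CB GcA GcB l)"

text \<open>
  Locally uniform convergence on an open set \<open>S\<close> of extended-real functions to a real function; for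
  large \<open>n\<close> the functions are then finite on each compact subset of \<open>S\<close>.
\<close>

definition locally_uniformly_tendsto ::
    "real set \<Rightarrow> (nat \<Rightarrow> real \<Rightarrow> ereal) \<Rightarrow> (real \<Rightarrow> real) \<Rightarrow> bool" where
  "locally_uniformly_tendsto S F f \<longleftrightarrow>
     (\<forall>K. compact K \<and> K \<subseteq> S \<longrightarrow>
        (\<forall>\<epsilon>>0. \<forall>\<^sub>F n in sequentially. \<forall>x\<in>K. \<bar>F n x - ereal (f x)\<bar> < ereal \<epsilon>))"

end

theory Submission
  imports Defs
begin

text \<open>
  Everything rests on one regularity fact: for a constant diagonal stiffness the elastic energy is a
  nonincreasing \<open>C\<^sup>1\<close> function of the crack length in \<open>(0, L)\<close>. Hence \<open>G\<^sub>h\<^sub>o\<^sub>m\<close> is continuous and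
  nonnegative, so \<open>G\<^sub>h\<^sub>o\<^sub>m(l) > 0\<close>. Locally uniform convergence to a continuous limit makes
  \<open>G\<^sub>n(l\<^sub>n)\<close> converge to \<open>G\<^sub>h\<^sub>o\<^sub>m(l)\<close> along every sequence \<open>l\<^sub>n \<longlonglongrightarrow> l\<close>. The quotients
  \<open>G\<^sub>n(l\<^sub>n) / G\<^sup>c\<^sub>n(l\<^sub>n)\<close> then have lower limit at least \<open>G\<^sub>h\<^sub>o\<^sub>m(l) / max G\<^sup>c\<^sub>A G\<^sup>c\<^sub>B\<close>, and since the layers
  become arbitrarily thin there are points \<open>l\<^sub>n \<longlonglongrightarrow> l\<close> in the tougher material, where this value is
  attained.

  For the regularity fix a reference length \<open>a\<close> and stretch the horizontal variable linearly on each
  side of \<open>a\<close>, keeping \<open>0\<close> and \<open>L\<close> and moving \<open>a\<close> to \<open>b\<close>. Vertical sides are fixed pointwise, so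
  traces are unchanged, and the functions admissible for the crack of length \<open>b\<close> become those
  admissible for length \<open>a\<close>. Since the stiffness does not depend on the position, the energy of a
  competitor is transformed into \<open>p/s + s q + p'/t + t q'\<close>, where \<open>s = b/a\<close> and
  \<open>t = (L - b)/(L - a)\<close> are the two slopes and \<open>p, q, p', q'\<close> are the contributions of the horizontal
  and vertical derivatives on the two sides of \<open>a\<close> (lemma \<open>energy_stretched\<close>). So the energy at \<open>b\<close>
  is the infimum of these expressions over a set of quadruples that is independent of \<open>b\<close>.

  In the coordinates \<open>sqrt p, \<dots>\<close> the expression is a positive definite diagonal quadratic form, and
  Minkowski's inequality makes the set of quadruples midpoint convex, up to decreasing coordinates.
  By the parallelogram law the quadratic form has a unique minimiser on the closed convex set in
  \<open>\<real>\<^sup>4\<close> generated by these points and all larger ones; it depends continuously on \<open>b\<close>, and the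
  minimum is differentiated by differentiating the coefficients only (lemma
  \<open>infimum_of_weighted_energies_C1\<close>). The derivative is nonpositive because a longer crack admits
  more competitors.

  The remaining work is the chain rule for weak gradients under a stretching that has a kink (lemma
  \<open>H1_stretch\<close>). The transported test functions are only Lipschitz, so the inverse stretching is
  replaced by a smooth approximation, with \<open>\<bar>x\<bar>\<close> replaced by \<open>sqrt (x\<^sup>2 + \<epsilon>\<^sup>2)\<close>, and the identities are
  obtained by dominated convergence.
\<close>

section \<open>Minimising a moving quadratic form over a fixed convex set\<close>

definition weighted_energy :: "('n::finite \<Rightarrow> real \<Rightarrow> real) \<Rightarrow> real \<Rightarrow> real ^ 'n \<Rightarrow> real" where
  "weighted_energy w l x = (\<Sum>i\<in>UNIV. w i l * (x $ i)\<^sup>2)"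

lemma weighted_energy_coercive:
  fixes w :: "'n::finite \<Rightarrow> real \<Rightarrow> real"
  assumes "\<And>i. w i l > 0"
  obtains m where "m > 0" "\<And>x. m * (norm x)\<^sup>2 \<le> weighted_energy w l x"
proof
  let ?m = "Min (range (\<lambda>i. w i l))"
  show "?m > 0" using assms by simp
  fix x :: "real ^ 'n"
  have "?m * (norm x)\<^sup>2 = (\<Sum>i\<in>UNIV. ?m * (x $ i)\<^sup>2)"
    by (simp only: power2_norm_eq_inner inner_vec_def sum_distrib_left) (simp add: power2_eq_square)
  also have "\<dots> \<le> weighted_energy w l x"
    unfolding weighted_energy_def by (intro sum_mono mult_right_mono) auto
  finally show "?m * (norm x)\<^sup>2 \<le> weighted_energy w l x" .
qed

lemma weighted_energy_parallelogram:
  "weighted_energy w l ((1/2) *\<^sub>R (x + y)) + weighted_energy w l (x - y) / 4 =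
    (weighted_energy w l x + weighted_energy w l y) / 2"
  unfolding weighted_energy_def sum_divide_distrib sum.distrib[symmetric]
  by (intro sum.cong) (auto simp: power2_eq_square field_simps)

lemma continuous_weighted_energy: "continuous_on S (weighted_energy w l)"
  unfolding weighted_energy_def[abs_def] by (intro continuous_intros)

lemma weighted_energy_le_scaled:
  assumes "\<And>i. w i l \<le> c * w i l'"
  shows "weighted_energy w l x \<le> c * weighted_energy w l' x"
  unfolding weighted_energy_def sum_distrib_left mult.assoc[symmetric]
  by (intro sum_mono mult_right_mono assms) auto

text \<open>
  A quadratic form that varies with \<open>l\<close> is minimised over a set \<open>C\<close> that does not. Convexity of \<open>C\<close> is
  expressed through midpoints because this is what the parallelogram law uses.
\<close>

locale weighted_minimum =
  fixes C :: "(real ^ 'n::finite) set" and w w' :: "'n \<Rightarrow> real \<Rightarrow> real" and I :: "real set"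
  assumes closed_C: "closed C" and C_ne: "C \<noteq> {}"
    and mid: "\<And>x y. x \<in> C \<Longrightarrow> y \<in> C \<Longrightarrow> (1/2) *\<^sub>R (x + y) \<in> C"
    and open_I: "open I"
    and w_pos: "\<And>i l. l \<in> I \<Longrightarrow> w i l > 0"
    and w_deriv: "\<And>i l. l \<in> I \<Longrightarrow> (w i has_real_derivative w' i l) (at l)"
    and w'_cont: "\<And>i. continuous_on I (w' i)"
begin

abbreviation "N \<equiv> weighted_energy w"

lemma minimizer_exists:
  assumes l: "l \<in> I"
  shows "\<exists>x\<in>C. \<forall>y\<in>C. N l x \<le> N l y"
proof -
  obtain m where m: "m > 0" "\<And>x. m * (norm x)\<^sup>2 \<le> N l x"
    using weighted_energy_coercive w_pos[OF l] by metis
  obtain x0 where x0: "x0 \<in> C" using C_ne by blast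
  define R where "R = sqrt (N l x0 / m)"
  have "0 \<le> N l x0" using order_trans[OF _ m(2)[of x0]] m(1) by simp
  then have R2: "R\<^sup>2 = N l x0 / m" and R0: "R \<ge> 0" using m by (simp_all add: R_def)
  have in_ball: "norm y \<le> R" if "N l y \<le> N l x0" for y
  proof -
    have "m * (norm y)\<^sup>2 \<le> N l x0" using m(2)[of y] that by simp
    then have "(norm y)\<^sup>2 \<le> R\<^sup>2" using m(1) by (simp add: R2 field_simps)
    then show ?thesis by (rule power2_le_imp_le[OF _ R0])
  qed
  have "compact (C \<inter> cball 0 R)" "C \<inter> cball 0 R \<noteq> {}"
    using closed_C in_ball[of x0] x0 by (auto simp: closed_Int_compact)
  from continuous_attains_inf[OF this continuous_weighted_energy[of _ w l]]
  obtain x where x: "x \<in> C" "\<And>y. y \<in> C \<Longrightarrow> norm y \<le> R \<Longrightarrow> N l x \<le> N l y" by auto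
  have "N l x \<le> N l y" if y: "y \<in> C" for y
  proof (cases "N l y \<le> N l x0")
    case True
    then show ?thesis using x(2)[OF y in_ball] by simp
  next
    case False
    then show ?thesis using x(2)[OF x0 in_ball] by simp
  qed
  with x show ?thesis by blast
qed

definition minimizer :: "real \<Rightarrow> real ^ 'n" where
  "minimizer l = (SOME x. x \<in> C \<and> (\<forall>y\<in>C. N l x \<le> N l y))"

lemma minimizer:
  assumes "l \<in> I"
  shows "minimizer l \<in> C" "\<And>y. y \<in> C \<Longrightarrow> N l (minimizer l) \<le> N l y"
proof -
  have "minimizer l \<in> C \<and> (\<forall>y\<in>C. N l (minimizer l) \<le> N l y)"
    unfolding minimizer_def by (rule someI_ex) (use minimizer_exists[OF assms] in blast)
  then show "minimizer l \<in> C" "\<And>y. y \<in> C \<Longrightarrow> N l (minimizer l) \<le> N l y" by blast+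
qed

text \<open>
  The midpoint of a competitor and the minimiser is again a competitor, so by the parallelogram law the
  energy of their difference is controlled by the excess energy of the competitor.
\<close>

lemma minimizer_stable:
  assumes "l \<in> I" "y \<in> C"
  shows "N l (y - minimizer l) \<le> 2 * (N l y - N l (minimizer l))"
  using weighted_energy_parallelogram[of w l y "minimizer l"]
    minimizer(2)[OF assms(1) mid[OF assms(2) minimizer(1)[OF assms(1)]]] by simp

text \<open>
  For \<open>k\<close> near \<open>l\<close> the two forms differ by a factor close to \<open>1\<close>. So the minimiser at \<open>k\<close> is nearly
  optimal at \<open>l\<close>, and stability forces it to be close to the minimiser at \<open>l\<close>.
\<close>

lemma minimizer_continuous:
  assumes l: "l \<in> I"
  shows "(minimizer \<longlongrightarrow> minimizer l) (at l)"
proof -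
  obtain m where m: "m > 0" "\<And>x. m * (norm x)\<^sup>2 \<le> N l x"
    using weighted_energy_coercive w_pos[OF l] by metis
  define \<delta> where "\<delta> k = (\<Sum>i\<in>UNIV. \<bar>w i k / w i l - 1\<bar> + \<bar>w i l / w i k - 1\<bar>)" for k
  have wl: "(w i \<longlongrightarrow> w i l) (at l)" for i
    using DERIV_isCont[OF w_deriv[OF l]] by (simp add: isCont_def)
  have "(\<delta> \<longlongrightarrow> (\<Sum>i\<in>(UNIV :: 'n set). \<bar>w i l / w i l - 1\<bar> + \<bar>w i l / w i l - 1\<bar>)) (at l)"
    unfolding \<delta>_def[abs_def] using w_pos[OF l] by (intro tendsto_intros wl) (auto simp: less_imp_neq[symmetric])
  then have \<delta>: "(\<delta> \<longlongrightarrow> 0) (at l)" using w_pos[OF l] by (simp add: less_imp_neq[symmetric])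
  have bound: "m * (norm (minimizer k - minimizer l))\<^sup>2 \<le> 2 * ((1 + \<delta> k)\<^sup>2 - 1) * N l (minimizer l)"
    if k: "k \<in> I" for k
  proof -
    have le: "\<bar>w i k / w i l - 1\<bar> + \<bar>w i l / w i k - 1\<bar> \<le> \<delta> k" for i
      unfolding \<delta>_def by (rule member_le_sum) auto
    have "w i k / w i l \<le> 1 + \<delta> k" "w i l / w i k \<le> 1 + \<delta> k" for i using le[of i] by linarith+
    then have r: "w i k \<le> (1 + \<delta> k) * w i l" "w i l \<le> (1 + \<delta> k) * w i k" for i
      unfolding pos_divide_le_eq[OF w_pos[OF k]] pos_divide_le_eq[OF w_pos[OF l]] by blast+
    have \<delta>0: "0 \<le> \<delta> k" unfolding \<delta>_def by (intro sum_nonneg) auto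
    have "N l (minimizer k) \<le> (1 + \<delta> k) * N k (minimizer k)" by (rule weighted_energy_le_scaled) (rule r(2))
    also have "\<dots> \<le> (1 + \<delta> k) * N k (minimizer l)"
      using \<delta>0 by (intro mult_left_mono minimizer k l) auto
    also have "\<dots> \<le> (1 + \<delta> k) * ((1 + \<delta> k) * N l (minimizer l))"
      using \<delta>0 by (intro mult_left_mono weighted_energy_le_scaled r) auto
    finally have "N l (minimizer k) - N l (minimizer l) \<le> ((1 + \<delta> k)\<^sup>2 - 1) * N l (minimizer l)"
      by (simp add: power2_eq_square algebra_simps)
    then have "2 * (N l (minimizer k) - N l (minimizer l)) \<le> 2 * (((1 + \<delta> k)\<^sup>2 - 1) * N l (minimizer l))"
      by (rule mult_left_mono) simp
    with order_trans[OF m(2) minimizer_stable[OF l minimizer(1)[OF k]]]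
    show ?thesis unfolding mult.assoc by (rule order_trans)
  qed
  have "((\<lambda>k. 2 * ((1 + \<delta> k)\<^sup>2 - 1) * N l (minimizer l) / m) \<longlongrightarrow> 2 * ((1 + 0)\<^sup>2 - 1) * N l (minimizer l) / m) (at l)"
    using m(1) by (intro tendsto_intros \<delta>) auto
  then have up: "((\<lambda>k. 2 * ((1 + \<delta> k)\<^sup>2 - 1) * N l (minimizer l) / m) \<longlongrightarrow> 0) (at l)" by simp
  have "((\<lambda>k. (norm (minimizer k - minimizer l))\<^sup>2) \<longlongrightarrow> 0) (at l)"
  proof (rule tendsto_sandwich[OF _ _ tendsto_const up])
    show "\<forall>\<^sub>F k in at l. (norm (minimizer k - minimizer l))\<^sup>2 \<le> 2 * ((1 + \<delta> k)\<^sup>2 - 1) * N l (minimizer l) / m"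
      using eventually_at_in_open'[OF open_I l]
    proof eventually_elim
      case (elim k)
      then show ?case using bound[of k] m(1) by (simp add: pos_le_divide_eq mult.commute)
    qed
  qed simp
  from tendsto_real_sqrt[OF this] show ?thesis by (simp add: tendsto_norm_zero_iff LIM_zero_iff)
qed

text \<open>
  Testing the minimality at \<open>k\<close> and at \<open>l\<close> with the other minimiser encloses the difference quotient of
  the minimum between the difference quotients of the form at two points, and both tend to the same
  limit by continuity of the minimiser.
\<close>

theorem minimum_has_derivative:
  assumes l: "l \<in> I"
  shows "((\<lambda>l. N l (minimizer l)) has_real_derivative (\<Sum>i\<in>UNIV. w' i l * (minimizer l $ i)\<^sup>2)) (at l)"
proof -
  define D where "D i k = (w i k - w i l) / (k - l)" for i k
  let ?e = "\<lambda>k. N k (minimizer k)" and ?x = "minimizer l"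
  have D: "(D i \<longlongrightarrow> w' i l) (at l)" for i
    using w_deriv[OF l] unfolding D_def[abs_def] has_field_derivative_iff by blast
  have xi: "((\<lambda>k. minimizer k $ i) \<longlongrightarrow> ?x $ i) (at l)" for i
    by (intro tendsto_vec_nth minimizer_continuous l)
  define A where "A k = (\<Sum>i\<in>UNIV. D i k * (?x $ i)\<^sup>2)" for k
  define B where "B k = (\<Sum>i\<in>UNIV. D i k * (minimizer k $ i)\<^sup>2)" for k
  have A: "(A \<longlongrightarrow> (\<Sum>i\<in>UNIV. w' i l * (?x $ i)\<^sup>2)) (at l)"
    unfolding A_def[abs_def] by (intro tendsto_intros D)
  have B: "(B \<longlongrightarrow> (\<Sum>i\<in>UNIV. w' i l * (?x $ i)\<^sup>2)) (at l)"
    unfolding B_def[abs_def] by (intro tendsto_intros D xi)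
  have between: "min (A k) (B k) \<le> (?e k - ?e l) / (k - l) \<and> (?e k - ?e l) / (k - l) \<le> max (A k) (B k)"
    if k: "k \<in> I" "k \<noteq> l" for k
  proof -
    have diff: "N k x - N l x = (k - l) * (\<Sum>i\<in>UNIV. D i k * (x $ i)\<^sup>2)" for x
    proof -
      have Dk: "w i k - w i l = (k - l) * D i k" for i using k(2) by (simp add: D_def)
      show ?thesis
        by (simp only: weighted_energy_def sum_subtractf[symmetric] left_diff_distrib[symmetric] Dk
            sum_distrib_left mult.assoc)
    qed
    have "?e k - ?e l \<le> (k - l) * A k" unfolding A_def diff[symmetric]
      using minimizer(2)[OF k(1) minimizer(1)[OF l]] by simp
    moreover have "(k - l) * B k \<le> ?e k - ?e l" unfolding B_def diff[symmetric]
      using minimizer(2)[OF l minimizer(1)[OF k(1)]] by simp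
    ultimately show ?thesis
      using k(2) by (cases "k > l") (auto simp: field_simps min_le_iff_disj le_max_iff_disj)
  qed
  have "((\<lambda>k. (?e k - ?e l) / (k - l)) \<longlongrightarrow> (\<Sum>i\<in>UNIV. w' i l * (?x $ i)\<^sup>2)) (at l)"
  proof (rule tendsto_sandwich)
    have ev: "\<forall>\<^sub>F k in at l. k \<in> I \<and> k \<noteq> l"
      using eventually_at_in_open[OF open_I l] by simp
    show "\<forall>\<^sub>F k in at l. min (A k) (B k) \<le> (?e k - ?e l) / (k - l)"
      and "\<forall>\<^sub>F k in at l. (?e k - ?e l) / (k - l) \<le> max (A k) (B k)"
      using between by (auto intro: eventually_mono[OF ev])
    show "((\<lambda>k. min (A k) (B k)) \<longlongrightarrow> (\<Sum>i\<in>UNIV. w' i l * (?x $ i)\<^sup>2)) (at l)"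
      using tendsto_min[OF A B] by simp
    show "((\<lambda>k. max (A k) (B k)) \<longlongrightarrow> (\<Sum>i\<in>UNIV. w' i l * (?x $ i)\<^sup>2)) (at l)"
      using tendsto_max[OF A B] by simp
  qed
  then show ?thesis by (simp add: has_field_derivative_iff)
qed

lemma derivative_continuous:
  "continuous_on I (\<lambda>l. \<Sum>i\<in>UNIV. w' i l * (minimizer l $ i)\<^sup>2)"
proof -
  have "continuous_on I minimizer"
    by (intro continuous_at_imp_continuous_on ballI) (simp add: isCont_def minimizer_continuous)
  then show ?thesis by (intro continuous_intros w'_cont)
qed

end

text \<open>
  The infimum over \<open>S\<close> equals the minimum over the closed set generated by the vectors above some
  \<open>\<rho> p\<close>. Passing to larger vectors does not change the infimum because \<open>\<rho>\<close> is nonnegative, and it turns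
  the midpoint assumption, which is an inequality, into midpoint convexity.
\<close>

lemma infimum_of_weighted_energies_C1:
  fixes \<rho> :: "'a \<Rightarrow> real ^ 'n::finite"
  assumes S: "S \<noteq> {}" and nonneg: "\<And>p i. p \<in> S \<Longrightarrow> 0 \<le> \<rho> p $ i"
    and mid: "\<And>p q. p \<in> S \<Longrightarrow> q \<in> S \<Longrightarrow> \<exists>r\<in>S. \<forall>i. \<rho> r $ i \<le> (\<rho> p $ i + \<rho> q $ i) / 2"
    and I: "open I"
    and w: "\<And>i l. l \<in> I \<Longrightarrow> w i l > 0" "\<And>i l. l \<in> I \<Longrightarrow> (w i has_real_derivative w' i l) (at l)"
      "\<And>i. continuous_on I (w' i)"
  obtains E' where "continuous_on I E'"
    "\<And>l. l \<in> I \<Longrightarrow> ((\<lambda>l. INF p\<in>S. \<Sum>i\<in>UNIV. w i l * (\<rho> p $ i)\<^sup>2) has_real_derivative E' l) (at l)"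
proof -
  define C0 where "C0 = {x. \<exists>p\<in>S. \<forall>i. \<rho> p $ i \<le> x $ i}"
  have mid0: "(1/2) *\<^sub>R (x + y) \<in> C0" if xy: "x \<in> C0" "y \<in> C0" for x y
  proof -
    obtain p q where p: "p \<in> S" "\<And>i. \<rho> p $ i \<le> x $ i" and q: "q \<in> S" "\<And>i. \<rho> q $ i \<le> y $ i"
      using xy by (auto simp: C0_def)
    obtain r where r: "r \<in> S" "\<And>i. \<rho> r $ i \<le> (\<rho> p $ i + \<rho> q $ i) / 2" using mid[OF p(1) q(1)] by blast
    have "\<rho> r $ i \<le> ((1/2) *\<^sub>R (x + y)) $ i" for i using r(2)[of i] p(2)[of i] q(2)[of i] by simp
    with r(1) show ?thesis by (auto simp: C0_def)
  qed
  have mid_cl: "(1/2) *\<^sub>R (x + y) \<in> closure C0" if xy: "x \<in> closure C0" "y \<in> closure C0" for x y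
  proof -
    obtain a b where a: "\<And>n. a n \<in> C0" "a \<longlonglongrightarrow> x" and b: "\<And>n. b n \<in> C0" "b \<longlonglongrightarrow> y"
      using xy by (auto simp: closure_sequential)
    have "(\<lambda>n. (1/2) *\<^sub>R (a n + b n)) \<longlonglongrightarrow> (1/2) *\<^sub>R (x + y)" by (intro tendsto_intros a b)
    moreover have "(1/2) *\<^sub>R (a n + b n) \<in> C0" for n by (rule mid0[OF a(1) b(1)])
    ultimately show ?thesis unfolding closure_sequential
      by (intro exI[of _ "\<lambda>n. (1/2) *\<^sub>R (a n + b n)"]) blast
  qed
  have in_C0: "\<rho> p \<in> C0" if "p \<in> S" for p using that by (auto simp: C0_def)
  interpret weighted_minimum "closure C0" w w' I
    using S in_C0 closure_subset[of C0] by unfold_locales (auto intro: mid_cl[simplified] I w)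
  let ?E = "\<lambda>l. INF p\<in>S. weighted_energy w l (\<rho> p)"
  have E: "?E l = weighted_energy w l (minimizer l)" if l: "l \<in> I" for l
  proof (rule antisym)
    have N0: "0 \<le> weighted_energy w l x" for x
      unfolding weighted_energy_def using w(1)[OF l] by (intro sum_nonneg mult_nonneg_nonneg) (auto simp: less_imp_le)
    then have bdd: "bdd_below ((\<lambda>p. weighted_energy w l (\<rho> p)) ` S)" by (intro bdd_belowI[of _ 0]) auto
    show "weighted_energy w l (minimizer l) \<le> ?E l"
      using in_C0 closure_subset[of C0] by (intro cINF_greatest S minimizer(2) l) auto
    have "?E l \<le> weighted_energy w l x" if "x \<in> C0" for x
    proof -
      from that obtain p where p: "p \<in> S" "\<And>i. \<rho> p $ i \<le> x $ i" by (auto simp: C0_def)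
      have "?E l \<le> weighted_energy w l (\<rho> p)" by (rule cINF_lower[OF bdd p(1)])
      also have "\<dots> \<le> weighted_energy w l x"
        unfolding weighted_energy_def using w(1)[OF l] nonneg[OF p(1)] p(2)
        by (intro sum_mono mult_left_mono power_mono) (auto simp: less_imp_le)
      finally show ?thesis .
    qed
    then have "C0 \<subseteq> {x. ?E l \<le> weighted_energy w l x}" by blast
    moreover have "closed {x. ?E l \<le> weighted_energy w l x}"
      by (intro closed_Collect_le continuous_intros continuous_weighted_energy)
    ultimately have "closure C0 \<subseteq> {x. ?E l \<le> weighted_energy w l x}" by (rule closure_minimal)
    with minimizer(1)[OF l] show "?E l \<le> weighted_energy w l (minimizer l)" by blast
  qed
  have "(?E has_real_derivative (\<Sum>i\<in>UNIV. w' i l * (minimizer l $ i)\<^sup>2)) (at l)" if l: "l \<in> I" for l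
    using minimum_has_derivative[OF l]
    by (rule has_field_derivative_transform_within_open[OF _ I l]) (simp add: E)
  with derivative_continuous show ?thesis
    unfolding weighted_energy_def by (rule that)
qed

section \<open>Piecewise linear stretching of the horizontal variable\<close>

definition kink :: "real \<Rightarrow> real \<Rightarrow> real \<Rightarrow> real \<Rightarrow> real \<Rightarrow> real" where
  "kink a b s t x = b + (if x \<le> a then s else t) * (x - a)"

definition slope :: "real \<Rightarrow> real \<Rightarrow> real \<Rightarrow> real \<Rightarrow> real" where
  "slope a s t x = (if x \<le> a then s else t)"

definition stretch :: "real \<Rightarrow> real \<Rightarrow> real \<Rightarrow> real \<Rightarrow> real \<times> real \<Rightarrow> real \<times> real" where
  "stretch a b s t x = (kink a b s t (fst x), snd x)"

lemma kink_inverse: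
  assumes "s > 0" "t > 0"
  shows "kink b a (1/s) (1/t) (kink a b s t x) = x"
    and "slope b (1/s) (1/t) (kink a b s t x) = 1 / slope a s t x"
proof -
  have "kink a b s t x \<le> b \<longleftrightarrow> x \<le> a"
    using assms by (auto simp: kink_def mult_le_0_iff)
  then show "kink b a (1/s) (1/t) (kink a b s t x) = x"
    and "slope b (1/s) (1/t) (kink a b s t x) = 1 / slope a s t x"
    using assms by (auto simp: kink_def slope_def)
qed

text \<open>
  This form makes continuity evident and shows where the smoothing has to act.
\<close>

lemma kink_eq_abs: "kink a b s t x = b + (s + t) / 2 * (x - a) + (t - s) / 2 * \<bar>x - a\<bar>"
  by (auto simp: kink_def field_simps abs_if)

lemma continuous_kink: "continuous_on S (kink a b s t)"
  unfolding kink_eq_abs[abs_def] by (intro continuous_intros)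

lemma continuous_stretch: "continuous_on S (stretch a b s t)"
proof -
  have "continuous_on UNIV (\<lambda>x. kink a b s t (fst x))"
    by (rule continuous_on_compose2[OF continuous_kink[of UNIV]]) (auto intro!: continuous_intros)
  then show ?thesis
    unfolding stretch_def by (intro continuous_intros) (auto intro: continuous_on_subset)
qed

lemma kink_measurable [measurable]: "kink a b s t \<in> borel_measurable borel"
  by (intro borel_measurable_continuous_onI continuous_kink)

lemma stretch_measurable [measurable]: "stretch a b s t \<in> borel_measurable borel"
  by (intro borel_measurable_continuous_onI continuous_stretch)

lemma slope_measurable [measurable]: "slope a s t \<in> borel_measurable borel"
  unfolding slope_def by measurable

lemma fst_measurable_borel [measurable]: "(fst :: real \<times> real \<Rightarrow> real) \<in> borel_measurable borel"
  by (intro borel_measurable_continuous_onI continuous_intros)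

lemma slope_fst_measurable [measurable]:
  "(\<lambda>x :: real \<times> real. slope a s t (fst x)) \<in> borel_measurable borel"
  by (rule measurable_compose[OF fst_measurable_borel slope_measurable])

lemma nn_integral_kink:
  assumes "s > 0" "t > 0" and [measurable]: "f \<in> borel_measurable borel"
  shows "(\<integral>\<^sup>+y. f y \<partial>lborel) = (\<integral>\<^sup>+x. ennreal (slope a s t x) * f (kink a b s t x) \<partial>lborel)"
proof -
  have "(\<integral>\<^sup>+y. f y \<partial>lborel) = (\<integral>\<^sup>+y. f y * indicator {..b} y + f y * indicator {b<..} y \<partial>lborel)"
    by (intro nn_integral_cong) (auto split: split_indicator)
  also have "\<dots> = (\<integral>\<^sup>+y. f y * indicator {..b} y \<partial>lborel) + (\<integral>\<^sup>+y. f y * indicator {b<..} y \<partial>lborel)"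
    by (intro nn_integral_add) auto
  also have "(\<integral>\<^sup>+y. f y * indicator {..b} y \<partial>lborel) =
      s * (\<integral>\<^sup>+x. f ((b - s * a) + s * x) * indicator {..b} ((b - s * a) + s * x) \<partial>lborel)"
    using assms by (subst nn_integral_real_affine[where c = s and t = "b - s * a"]) auto
  also have "\<dots> = (\<integral>\<^sup>+x. s * (f ((b - s * a) + s * x) * indicator {..b} ((b - s * a) + s * x)) \<partial>lborel)"
    by (rule nn_integral_cmult[symmetric]) auto
  also have "\<dots> = (\<integral>\<^sup>+x. ennreal (slope a s t x) * f (kink a b s t x) * indicator {..a} x \<partial>lborel)"
    using assms
    by (intro nn_integral_cong)
      (auto simp: slope_def kink_def algebra_simps mult_le_cancel_left split: split_indicator)
  also have "(\<integral>\<^sup>+y. f y * indicator {b<..} y \<partial>lborel) =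
      t * (\<integral>\<^sup>+x. f ((b - t * a) + t * x) * indicator {b<..} ((b - t * a) + t * x) \<partial>lborel)"
    using assms by (subst nn_integral_real_affine[where c = t and t = "b - t * a"]) auto
  also have "\<dots> = (\<integral>\<^sup>+x. t * (f ((b - t * a) + t * x) * indicator {b<..} ((b - t * a) + t * x)) \<partial>lborel)"
    by (rule nn_integral_cmult[symmetric]) auto
  also have "\<dots> = (\<integral>\<^sup>+x. ennreal (slope a s t x) * f (kink a b s t x) * indicator {a<..} x \<partial>lborel)"
    using assms
    by (intro nn_integral_cong)
      (auto simp: slope_def kink_def algebra_simps mult_less_cancel_left split: split_indicator)
  also have "(\<integral>\<^sup>+x. ennreal (slope a s t x) * f (kink a b s t x) * indicator {..a} x \<partial>lborel) + \<dots>
     = (\<integral>\<^sup>+x. ennreal (slope a s t x) * f (kink a b s t x) * indicator {..a} x +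
              ennreal (slope a s t x) * f (kink a b s t x) * indicator {a<..} x \<partial>lborel)"
    by (intro nn_integral_add[symmetric]) auto
  also have "\<dots> = (\<integral>\<^sup>+x. ennreal (slope a s t x) * f (kink a b s t x) \<partial>lborel)"
    by (intro nn_integral_cong) (auto split: split_indicator)
  finally show ?thesis .
qed

lemma nn_integral_stretch:
  fixes f :: "real \<times> real \<Rightarrow> ennreal"
  assumes "s > 0" "t > 0" and f [measurable]: "f \<in> borel_measurable borel"
  shows "(\<integral>\<^sup>+y. f y \<partial>lborel) = (\<integral>\<^sup>+x. ennreal (slope a s t (fst x)) * f (stretch a b s t x) \<partial>lborel)"
proof -
  have f': "f \<in> borel_measurable (lborel \<Otimes>\<^sub>M lborel)" unfolding lborel_prod using f by simp
  have [measurable]: "(\<lambda>y. f (y, z)) \<in> borel_measurable borel" for z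
    by (rule measurable_compose[OF _ f]) (auto intro!: borel_measurable_continuous_onI continuous_intros)
  have g: "(\<lambda>x. ennreal (slope a s t (fst x)) * f (stretch a b s t x)) \<in> borel_measurable (lborel \<Otimes>\<^sub>M lborel)"
  proof -
    have "(\<lambda>x :: real \<times> real. ennreal (slope a s t (fst x))) \<in> borel_measurable borel"
      by (rule measurable_compose[OF slope_fst_measurable]) simp
    moreover have "(\<lambda>x. f (stretch a b s t x)) \<in> borel_measurable borel"
      by (rule measurable_compose[OF stretch_measurable f])
    ultimately show ?thesis unfolding lborel_prod by simp
  qed
  have "(\<integral>\<^sup>+y. f y \<partial>lborel) = (\<integral>\<^sup>+y2. \<integral>\<^sup>+y1. f (y1, y2) \<partial>lborel \<partial>lborel)"
    using lborel_pair.nn_integral_snd[OF f'] by (simp add: lborel_prod)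
  also have "\<dots> = (\<integral>\<^sup>+y2. \<integral>\<^sup>+x1. ennreal (slope a s t x1) * f (stretch a b s t (x1, y2)) \<partial>lborel \<partial>lborel)"
    unfolding stretch_def fst_conv snd_conv by (intro nn_integral_cong nn_integral_kink assms) simp
  also have "\<dots> = (\<integral>\<^sup>+x. ennreal (slope a s t (fst x)) * f (stretch a b s t x) \<partial>lborel)"
    using lborel_pair.nn_integral_snd[OF g] by (simp add: lborel_prod)
  finally show ?thesis .
qed

text \<open>
  Stating the change of variables for measures yields it for all measurable integrands at once, with
  no case distinction on integrability.
\<close>

lemma distr_stretch:
  assumes "s > 0" "t > 0"
  shows "distr (density lborel (\<lambda>x. ennreal (slope a s t (fst x)))) borel (stretch a b s t) = lborel"
proof (rule measure_eqI)
  fix A assume "A \<in> sets (distr (density lborel (\<lambda>x. ennreal (slope a s t (fst x)))) borel (stretch a b s t))"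
  then have [measurable]: "A \<in> sets borel" by simp
  have "emeasure lborel A = (\<integral>\<^sup>+x. ennreal (slope a s t (fst x)) * indicator A (stretch a b s t x) \<partial>lborel)"
    using nn_integral_stretch[OF assms, of "indicator A" a b] by simp
  also have "\<dots> = (\<integral>\<^sup>+x. ennreal (slope a s t (fst x)) * indicator (stretch a b s t -` A) x \<partial>lborel)"
    by (intro nn_integral_cong) (auto split: split_indicator)
  also have "\<dots> = emeasure (density lborel (\<lambda>x. ennreal (slope a s t (fst x)))) (stretch a b s t -` A)"
    by (subst emeasure_density)
      (auto intro!: measurable_sets_borel[OF stretch_measurable] measurable_compose[OF slope_fst_measurable])
  finally show "emeasure (distr (density lborel (\<lambda>x. ennreal (slope a s t (fst x)))) borel (stretch a b s t)) A
      = emeasure lborel A"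
    by (simp add: emeasure_distr)
qed simp

lemma
  fixes f :: "real \<times> real \<Rightarrow> real"
  assumes "s > 0" "t > 0" and [measurable]: "f \<in> borel_measurable borel"
  shows integrable_stretch: "integrable lborel (\<lambda>x. slope a s t (fst x) * f (stretch a b s t x)) \<longleftrightarrow> integrable lborel f"
    and integral_stretch: "(LINT x|lborel. slope a s t (fst x) * f (stretch a b s t x)) = (LINT y|lborel. f y)"
proof -
  have nn: "AE x in lborel. 0 \<le> slope a s t (fst x)" using assms by (auto simp: slope_def)
  have [measurable]: "(\<lambda>x. f (stretch a b s t x)) \<in> borel_measurable borel"
    by (rule measurable_compose[OF stretch_measurable]) measurable
  show "integrable lborel (\<lambda>x. slope a s t (fst x) * f (stretch a b s t x)) \<longleftrightarrow> integrable lborel f"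
  proof -
    have "integrable lborel f \<longleftrightarrow>
        integrable (density lborel (\<lambda>x. ennreal (slope a s t (fst x)))) (\<lambda>x. f (stretch a b s t x))"
      by (subst (1) distr_stretch[OF assms(1,2), symmetric, of a b], subst integrable_distr_eq) auto
    also have "\<dots> \<longleftrightarrow> integrable lborel (\<lambda>x. slope a s t (fst x) *\<^sub>R f (stretch a b s t x))"
      using nn by (intro integrable_density) auto
    finally show ?thesis by simp
  qed
  show "(LINT x|lborel. slope a s t (fst x) * f (stretch a b s t x)) = (LINT y|lborel. f y)"
  proof -
    have "(LINT y|lborel. f y) =
        (LINT x|density lborel (\<lambda>x. ennreal (slope a s t (fst x))). f (stretch a b s t x))"
      by (subst (1) distr_stretch[OF assms(1,2), symmetric, of a b], subst integral_distr) auto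
    also have "\<dots> = (LINT x|lborel. slope a s t (fst x) *\<^sub>R f (stretch a b s t x))"
      using nn by (intro integral_density) auto
    finally show ?thesis by simp
  qed
qed

section \<open>Smooth approximations of a stretching\<close>

lemma C_k_SucI:
  "(\<And>x. (f has_derivative (\<lambda>h. f1 x * fst h + f2 x * snd h)) (at x)) \<Longrightarrow> C_k k f1 \<Longrightarrow> C_k k f2
    \<Longrightarrow> C_k (Suc k) f"
  unfolding C_k.simps by blast

lemma C_k_continuous:
  assumes "C_k k f"
  shows "continuous_on UNIV f"
proof (cases k)
  case 0
  then show ?thesis using assms by simp
next
  case (Suc j)
  with assms obtain f1 f2 where
    f: "\<And>x. (f has_derivative (\<lambda>h. f1 x * fst h + f2 x * snd h)) (at x)"
    unfolding Suc C_k.simps by blast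
  show ?thesis by (intro continuous_at_imp_continuous_on ballI has_derivative_continuous[OF f])
qed

lemma C_k_Suc_D: "C_k (Suc k) f \<Longrightarrow> C_k k f"
proof (induction k arbitrary: f)
  case 0
  then show ?case using C_k_continuous by (simp del: C_k.simps(2))
next
  case (Suc k)
  from Suc.prems obtain f1 f2 where
    "\<And>x. (f has_derivative (\<lambda>h. f1 x * fst h + f2 x * snd h)) (at x)"
    "C_k (Suc k) f1" "C_k (Suc k) f2" by (subst (asm) C_k.simps(2)) blast
  then show ?case using Suc.IH by (intro C_k_SucI[of f f1 f2]) blast+
qed

lemma C_k_const: "C_k k (\<lambda>_. c)"
proof (induction k arbitrary: c)
  case (Suc k)
  show ?case by (rule C_k_SucI[OF _ Suc Suc, of _ 0 0]) simp
qed simp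

lemma C_k_fst: "C_k k (\<lambda>x. fst x)"
proof (cases k)
  case (Suc j)
  show ?thesis
    unfolding Suc by (rule C_k_SucI[OF _ C_k_const C_k_const, of _ 1 0])
      (simp add: has_derivative_fst)
qed (simp add: continuous_on_fst)

lemma C_k_add: "C_k k f \<Longrightarrow> C_k k g \<Longrightarrow> C_k k (\<lambda>x. f x + g x)"
proof (induction k arbitrary: f g)
  case 0
  then show ?case by (auto intro!: continuous_intros)
next
  case (Suc k)
  from Suc.prems obtain f1 f2 g1 g2 where
    f: "\<And>x. (f has_derivative (\<lambda>h. f1 x * fst h + f2 x * snd h)) (at x)" "C_k k f1" "C_k k f2" and
    g: "\<And>x. (g has_derivative (\<lambda>h. g1 x * fst h + g2 x * snd h)) (at x)" "C_k k g1" "C_k k g2"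
    unfolding C_k.simps by blast
  show ?case
  proof (rule C_k_SucI[of _ "\<lambda>x. f1 x + g1 x" "\<lambda>x. f2 x + g2 x"])
    fix x show "((\<lambda>x. f x + g x) has_derivative (\<lambda>h. (f1 x + g1 x) * fst h + (f2 x + g2 x) * snd h)) (at x)"
      by (rule derivative_eq_intros f(1) g(1) refl)+ (auto simp: algebra_simps)
  qed (use f g Suc.IH in auto)
qed

lemma C_k_mult: "C_k k f \<Longrightarrow> C_k k g \<Longrightarrow> C_k k (\<lambda>x. f x * g x)"
proof (induction k arbitrary: f g)
  case 0
  then show ?case by (auto intro!: continuous_intros)
next
  case (Suc k)
  from Suc.prems obtain f1 f2 g1 g2 where
    f: "\<And>x. (f has_derivative (\<lambda>h. f1 x * fst h + f2 x * snd h)) (at x)" "C_k k f1" "C_k k f2" and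
    g: "\<And>x. (g has_derivative (\<lambda>h. g1 x * fst h + g2 x * snd h)) (at x)" "C_k k g1" "C_k k g2"
    unfolding C_k.simps by blast
  have fg: "C_k k f" "C_k k g" using Suc.prems by (blast dest: C_k_Suc_D)+
  show ?case
  proof (rule C_k_SucI[of _ "\<lambda>x. f1 x * g x + f x * g1 x" "\<lambda>x. f2 x * g x + f x * g2 x"])
    fix x show "((\<lambda>x. f x * g x) has_derivative
        (\<lambda>h. (f1 x * g x + f x * g1 x) * fst h + (f2 x * g x + f x * g2 x) * snd h)) (at x)"
      by (rule derivative_eq_intros f(1) g(1) refl)+ (auto simp: algebra_simps)
  qed (intro C_k_add Suc.IH f g fg)+
qed

lemma has_derivative_compose_fst:
  fixes f :: "real \<times> real \<Rightarrow> real"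
  assumes "(p has_real_derivative p') (at (fst x))"
    and "(f has_derivative (\<lambda>h. c * fst h + d * snd h)) (at (p (fst x), snd x))"
  shows "((\<lambda>x. f (p (fst x), snd x)) has_derivative (\<lambda>h. p' * c * fst h + d * snd h)) (at x)"
proof -
  have "((\<lambda>x. p (fst x)) has_derivative (\<lambda>h. p' * fst h)) (at x)"
    using has_derivative_compose[OF has_derivative_fst[OF has_derivative_ident]
        assms(1)[unfolded has_field_derivative_def]] by simp
  then have "((\<lambda>x. (p (fst x), snd x)) has_derivative (\<lambda>h. (p' * fst h, snd h))) (at x)"
    by (intro has_derivative_Pair has_derivative_snd has_derivative_ident)
  from has_derivative_compose[OF this assms(2)] show ?thesis by (simp add: algebra_simps)
qed

lemma C_k_compose_fst:
  assumes p: "\<And>y. (p has_real_derivative p' y) (at y)" and p': "\<And>k. C_k k (\<lambda>x. p' (fst x))"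
    and "C_k k f"
  shows "C_k k (\<lambda>x. f (p (fst x), snd x))"
  using \<open>C_k k f\<close>
proof (induction k arbitrary: f)
  case 0
  have "continuous_on UNIV p" by (intro continuous_at_imp_continuous_on ballI DERIV_isCont[OF p])
  then have "continuous_on UNIV (\<lambda>x. p (fst x))"
    by (rule continuous_on_compose2) (auto intro!: continuous_intros)
  then have "continuous_on UNIV (\<lambda>x. (p (fst x), snd x))"
    by (auto intro!: continuous_intros)
  with 0 show ?case using continuous_on_compose2[of UNIV f UNIV "\<lambda>x. (p (fst x), snd x)"] by simp
next
  case (Suc k)
  from Suc.prems obtain f1 f2 where
    f: "\<And>x. (f has_derivative (\<lambda>h. f1 x * fst h + f2 x * snd h)) (at x)" "C_k k f1" "C_k k f2"
    unfolding C_k.simps by blast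
  show ?case
  proof (rule C_k_SucI[of _ "\<lambda>x. f1 (p (fst x), snd x) * p' (fst x)" "\<lambda>x. f2 (p (fst x), snd x)"])
    fix x :: "real \<times> real"
    show "((\<lambda>x. f (p (fst x), snd x)) has_derivative
        (\<lambda>h. f1 (p (fst x), snd x) * p' (fst x) * fst h + f2 (p (fst x), snd x) * snd h)) (at x)"
      using has_derivative_compose_fst[OF p f(1), of x] by (simp add: ac_simps)
  next
    show "C_k k (\<lambda>x. f1 (p (fst x), snd x) * p' (fst x))"
      by (rule C_k_mult[OF Suc.IH[OF f(2)] p'])
    show "C_k k (\<lambda>x. f2 (p (fst x), snd x))"
      by (rule Suc.IH[OF f(3)])
  qed
qed

text \<open>
  The stretching \<open>kink\<close> with its absolute value \<open>\<bar>x - a\<bar>\<close> smoothed at scale \<open>\<epsilon>\<close>.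
\<close>

definition smooth_kink :: "real \<Rightarrow> real \<Rightarrow> real \<Rightarrow> real \<Rightarrow> real \<Rightarrow> real \<Rightarrow> real" where
  "smooth_kink \<epsilon> a b s t x = b + (s + t) / 2 * (x - a) + (t - s) / 2 * sqrt ((x - a)\<^sup>2 + \<epsilon>\<^sup>2)"

definition smooth_slope :: "real \<Rightarrow> real \<Rightarrow> real \<Rightarrow> real \<Rightarrow> real \<Rightarrow> real" where
  "smooth_slope \<epsilon> a s t x = (s + t) / 2 + (t - s) / 2 * ((x - a) * inverse (sqrt ((x - a)\<^sup>2 + \<epsilon>\<^sup>2)))"

lemma smooth_abs_derivative:
  fixes a x \<epsilon> :: real
  assumes "\<epsilon> > 0"
  shows "((\<lambda>y. sqrt ((y - a)\<^sup>2 + \<epsilon>\<^sup>2)) has_real_derivative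
      (x - a) * inverse (sqrt ((x - a)\<^sup>2 + \<epsilon>\<^sup>2))) (at x)"
proof -
  have pos: "(x - a)\<^sup>2 + \<epsilon>\<^sup>2 > 0" using assms by (simp add: add_nonneg_pos)
  have "((\<lambda>y. (y - a)\<^sup>2 + \<epsilon>\<^sup>2) has_real_derivative 2 * (x - a)) (at x)"
    by (auto intro!: derivative_eq_intros)
  from DERIV_chain2[OF DERIV_real_sqrt[OF pos] this] show ?thesis
    by (rule DERIV_cong) (simp del: right_diff_distrib_numeral)
qed

text \<open>
  The derivative of \<open>r = 1 / sqrt (z\<^sup>2 + \<epsilon>\<^sup>2)\<close> is the polynomial \<open>- z r\<^sup>3\<close> in \<open>z\<close> and \<open>r\<close>, which drives the
  induction on the order of differentiability.
\<close>

lemma C_k_inverse_sqrt: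
  assumes "\<epsilon> > 0"
  shows "C_k k (\<lambda>x. inverse (sqrt ((fst x - a)\<^sup>2 + \<epsilon>\<^sup>2)))"
proof (induction k)
  case 0
  have "sqrt ((fst x - a)\<^sup>2 + \<epsilon>\<^sup>2) \<noteq> 0" for x :: "real \<times> real"
    using assms by (simp add: add_nonneg_eq_0_iff)
  then show ?case by (auto intro!: continuous_intros)
next
  case (Suc k)
  let ?r = "\<lambda>x :: real \<times> real. inverse (sqrt ((fst x - a)\<^sup>2 + \<epsilon>\<^sup>2))"
  let ?d = "\<lambda>x. (-1) * ((fst x + (- a)) * (?r x * (?r x * ?r x)))"
  show ?case
  proof (rule C_k_SucI[of _ ?d "\<lambda>_. 0"])
    fix x :: "real \<times> real"
    have pos: "(fst x - a)\<^sup>2 + \<epsilon>\<^sup>2 > 0" using assms by (simp add: add_nonneg_pos)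
    define r where "r = sqrt ((fst x - a)\<^sup>2 + \<epsilon>\<^sup>2)"
    have r: "r > 0" using pos by (simp add: r_def)
    have "((\<lambda>y. sqrt ((y - a)\<^sup>2 + \<epsilon>\<^sup>2)) has_real_derivative (fst x - a) / r) (at (fst x))"
      using smooth_abs_derivative[OF assms] by (simp add: r_def divide_inverse)
    moreover have "sqrt ((fst x - a)\<^sup>2 + \<epsilon>\<^sup>2) \<noteq> 0" using r unfolding r_def by linarith
    ultimately have "((\<lambda>y. inverse (sqrt ((y - a)\<^sup>2 + \<epsilon>\<^sup>2))) has_real_derivative
        - (inverse r * ((fst x - a) / r) * inverse r)) (at (fst x))"
      unfolding r_def by (rule DERIV_inverse')
    then have "((\<lambda>y. inverse (sqrt ((y - a)\<^sup>2 + \<epsilon>\<^sup>2))) has_real_derivative ?d x) (at (fst x))"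
      by (rule DERIV_cong) (simp add: r_def[symmetric] divide_inverse)
    from has_derivative_compose[OF has_derivative_fst[OF has_derivative_ident]
          this[unfolded has_field_derivative_def]]
    show "(?r has_derivative (\<lambda>h. ?d x * fst h + 0 * snd h)) (at x)" by simp
    show "C_k k ?d"
      by (intro C_k_mult C_k_add C_k_const C_k_fst Suc.IH)
  qed (rule C_k_const)
qed

lemma C_k_smooth_slope: "\<epsilon> > 0 \<Longrightarrow> C_k k (\<lambda>x. smooth_slope \<epsilon> a s t (fst x))"
  unfolding smooth_slope_def diff_conv_add_uminus[of "fst _"]
  by (intro C_k_add C_k_mult C_k_const C_k_fst C_k_inverse_sqrt[unfolded diff_conv_add_uminus[of "fst _"]])

lemma smooth_kink_derivative:
  assumes "\<epsilon> > 0"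
  shows "(smooth_kink \<epsilon> a b s t has_real_derivative smooth_slope \<epsilon> a s t x) (at x)"
proof -
  have "(smooth_kink \<epsilon> a b s t has_real_derivative
      0 + (s + t) / 2 * (1 - 0) + (t - s) / 2 * ((x - a) * inverse (sqrt ((x - a)\<^sup>2 + \<epsilon>\<^sup>2)))) (at x)"
    unfolding smooth_kink_def[abs_def]
    by (intro DERIV_add DERIV_const DERIV_cmult DERIV_diff DERIV_ident smooth_abs_derivative[OF assms])
  then show ?thesis by (simp add: smooth_slope_def)
qed

lemma smooth_kink_close:
  assumes "\<epsilon> > 0"
  shows "\<bar>smooth_kink \<epsilon> a b s t x - kink a b s t x\<bar> \<le> \<bar>t - s\<bar> / 2 * \<epsilon>"
proof -
  have "sqrt ((x - a)\<^sup>2 + \<epsilon>\<^sup>2) \<le> \<bar>x - a\<bar> + \<epsilon>"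
    using sqrt_add_le_add_sqrt[of "(x - a)\<^sup>2" "\<epsilon>\<^sup>2"] assms by simp
  moreover have "sqrt ((x - a)\<^sup>2 + \<epsilon>\<^sup>2) \<ge> \<bar>x - a\<bar>"
    by (rule real_le_rsqrt) simp
  ultimately have "\<bar>sqrt ((x - a)\<^sup>2 + \<epsilon>\<^sup>2) - \<bar>x - a\<bar>\<bar> \<le> \<epsilon>" by linarith
  then have "\<bar>(t - s) / 2\<bar> * \<bar>sqrt ((x - a)\<^sup>2 + \<epsilon>\<^sup>2) - \<bar>x - a\<bar>\<bar> \<le> \<bar>t - s\<bar> / 2 * \<epsilon>"
    by (intro mult_mono) auto
  then show ?thesis
    unfolding smooth_kink_def kink_eq_abs abs_mult[symmetric] by (simp add: algebra_simps)
qed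

lemma smooth_slope_bounded:
  assumes "\<epsilon> > 0"
  shows "\<bar>smooth_slope \<epsilon> a s t x\<bar> \<le> \<bar>s\<bar> + \<bar>t\<bar>"
proof -
  have "sqrt ((x - a)\<^sup>2 + \<epsilon>\<^sup>2) \<ge> \<bar>x - a\<bar>"
    by (rule real_le_rsqrt) simp
  moreover have "sqrt ((x - a)\<^sup>2 + \<epsilon>\<^sup>2) > 0" using assms by (simp add: add_nonneg_pos)
  ultimately have "\<bar>(x - a) * inverse (sqrt ((x - a)\<^sup>2 + \<epsilon>\<^sup>2))\<bar> \<le> 1"
    by (simp add: abs_mult divide_inverse[symmetric])
  then have "\<bar>(t - s) / 2\<bar> * \<bar>(x - a) * inverse (sqrt ((x - a)\<^sup>2 + \<epsilon>\<^sup>2))\<bar> \<le> \<bar>(t - s) / 2\<bar> * 1"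
    by (intro mult_left_mono) auto
  then have "\<bar>(t - s) / 2 * ((x - a) * inverse (sqrt ((x - a)\<^sup>2 + \<epsilon>\<^sup>2)))\<bar> \<le> \<bar>(t - s) / 2\<bar>"
    unfolding abs_mult[symmetric] by simp
  moreover have "\<bar>(s + t) / 2 + w\<bar> \<le> \<bar>s\<bar> + \<bar>t\<bar>" if "\<bar>w\<bar> \<le> \<bar>(t - s) / 2\<bar>" for w
  proof -
    have "\<bar>(t - s) / 2\<bar> \<le> (\<bar>s\<bar> + \<bar>t\<bar>) / 2" "\<bar>(s + t) / 2\<bar> \<le> (\<bar>s\<bar> + \<bar>t\<bar>) / 2" by simp_all
    with that abs_triangle_ineq[of "(s + t) / 2" w] show ?thesis by simp
  qed
  ultimately show ?thesis unfolding smooth_slope_def by blast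
qed

lemma smooth_slope_tendsto:
  assumes "x \<noteq> a" "e \<longlonglongrightarrow> 0"
  shows "(\<lambda>j. smooth_slope (e j) a s t x) \<longlonglongrightarrow> slope a s t x"
proof -
  have "(\<lambda>j. smooth_slope (e j) a s t x) \<longlonglongrightarrow>
      (s + t) / 2 + (t - s) / 2 * ((x - a) * inverse (sqrt ((x - a)\<^sup>2 + 0\<^sup>2)))"
    unfolding smooth_slope_def using assms by (intro tendsto_intros) auto
  also have "(s + t) / 2 + (t - s) / 2 * ((x - a) * inverse (sqrt ((x - a)\<^sup>2 + 0\<^sup>2))) = slope a s t x"
    using assms by (auto simp: slope_def abs_if field_simps)
  finally show ?thesis .
qed

lemma smooth_kink_tendsto:
  assumes "\<And>j. e j > 0" "e \<longlonglongrightarrow> 0"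
  shows "(\<lambda>j. smooth_kink (e j) a b s t x) \<longlonglongrightarrow> kink a b s t x"
proof -
  have "(\<lambda>j. \<bar>t - s\<bar> / 2 * e j) \<longlonglongrightarrow> \<bar>t - s\<bar> / 2 * 0" by (intro tendsto_intros assms)
  then have lim: "(\<lambda>j. \<bar>t - s\<bar> / 2 * e j) \<longlonglongrightarrow> 0" by simp
  have "(\<lambda>j. smooth_kink (e j) a b s t x - kink a b s t x) \<longlonglongrightarrow> 0"
  proof (rule Lim_null_comparison[OF _ lim])
    show "\<forall>\<^sub>F j in sequentially. norm (smooth_kink (e j) a b s t x - kink a b s t x) \<le> \<bar>t - s\<bar> / 2 * e j"
      unfolding real_norm_def by (intro always_eventually allI smooth_kink_close assms(1))
  qed
  then show ?thesis by (simp add: LIM_zero_iff)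
qed

lemma AE_fst_neq: "AE y in (lborel :: (real \<times> real) measure). fst y \<noteq> c"
proof -
  have "emeasure (lborel \<Otimes>\<^sub>M lborel) ({c} \<times> (UNIV :: real set)) = 0"
    by (subst lborel.emeasure_pair_measure_Times) auto
  then have "emeasure (lborel :: (real \<times> real) measure) ({c} \<times> UNIV) = 0"
    by (simp add: lborel_prod)
  then have "{c} \<times> UNIV \<in> null_sets (lborel :: (real \<times> real) measure)"
    by (intro null_setsI) (auto intro!: borel_closed closed_Times)
  from AE_not_in[OF this] show ?thesis by eventually_elim auto
qed

lemma AE_snd_neq: "AE y in (lborel :: (real \<times> real) measure). snd y \<noteq> c"
proof -
  have "emeasure (lborel \<Otimes>\<^sub>M lborel) ((UNIV :: real set) \<times> {c}) = 0"
    by (subst lborel.emeasure_pair_measure_Times) auto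
  then have "emeasure (lborel :: (real \<times> real) measure) (UNIV \<times> {c}) = 0"
    by (simp add: lborel_prod)
  then have "UNIV \<times> {c} \<in> null_sets (lborel :: (real \<times> real) measure)"
    by (intro null_setsI) (auto intro!: borel_closed closed_Times)
  from AE_not_in[OF this] show ?thesis by eventually_elim auto
qed

lemma L2_on_integrable:
  assumes "L2_on U f" and [measurable]: "U \<in> sets lborel" and fin: "emeasure lborel U < \<infinity>"
  shows "integrable lborel (\<lambda>x. indicator U x * f x)"
proof (rule Bochner_Integration.integrable_bound)
  have "integrable lborel (indicator U :: _ \<Rightarrow> real)"
    using assms by (intro integrable_real_indicator) auto
  then show "integrable lborel (\<lambda>x. indicator U x + indicator U x *\<^sub>R (f x)\<^sup>2)"
    using assms unfolding L2_on_def set_integrable_def by (intro Bochner_Integration.integrable_add) simp_all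
  show "(\<lambda>x. indicator U x * f x) \<in> borel_measurable lborel"
    using assms unfolding L2_on_def set_borel_measurable_def by simp
  have "\<bar>z\<bar> \<le> 1 + z\<^sup>2" for z :: real
  proof -
    have "0 \<le> (\<bar>z\<bar> - 1)\<^sup>2" by simp
    also have "\<dots> = z\<^sup>2 - 2 * \<bar>z\<bar> + 1" by (simp add: power2_diff)
    finally show ?thesis using zero_le_power2[of z] by linarith
  qed
  then show "AE x in lborel. norm (indicator U x * f x) \<le> norm (indicator U x + indicator U x *\<^sub>R (f x)\<^sup>2 :: real)"
    by (auto split: split_indicator intro!: AE_I2)
qed

lemma integral_bounded_factor_tendsto:
  fixes w :: "real \<times> real \<Rightarrow> real"
  assumes w: "integrable lborel w"
    and g: "\<And>j. g j \<in> borel_measurable borel" "h \<in> borel_measurable borel"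
    and B: "\<And>j x. \<bar>g j x\<bar> \<le> B"
    and lim: "AE x in lborel. (\<lambda>j. g j x) \<longlonglongrightarrow> h x"
  shows "(\<lambda>j. LINT x|lborel. w x * g j x) \<longlonglongrightarrow> (LINT x|lborel. w x * h x)"
proof (rule integral_dominated_convergence)
  note [measurable] = g borel_measurable_integrable[OF w]
  show "(\<lambda>x. w x * h x) \<in> borel_measurable lborel" "(\<lambda>x. w x * g j x) \<in> borel_measurable lborel" for j
    by measurable
  show "integrable lborel (\<lambda>x. \<bar>w x\<bar> * B)" using w by auto
  show "AE x in lborel. (\<lambda>j. w x * g j x) \<longlonglongrightarrow> w x * h x"
    using lim by eventually_elim (intro tendsto_intros)
  show "AE x in lborel. norm (w x * g j x) \<le> \<bar>w x\<bar> * B" for j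
    using B by (auto simp: abs_mult intro!: mult_left_mono)
qed

text \<open>
  The derivatives vanish off the support, so they inherit boundedness from compactness.
\<close>

lemma test_function_gradient:
  assumes "test_function V \<psi>"
  obtains f1 f2 B where
    "\<And>x. (\<psi> has_derivative (\<lambda>h. f1 x * fst h + f2 x * snd h)) (at x)"
    "continuous_on UNIV f1" "continuous_on UNIV f2" "continuous_on UNIV \<psi>"
    "\<And>x. \<bar>\<psi> x\<bar> \<le> B" "\<And>x. \<bar>f1 x\<bar> \<le> B" "\<And>x. \<bar>f2 x\<bar> \<le> B"
proof -
  let ?S = "closure {x. \<psi> x \<noteq> 0}"
  have "C_k (Suc 0) \<psi>" and S: "compact ?S" using assms by (auto simp: test_function_def simp del: C_k.simps)
  then obtain f1 f2 where d: "\<And>x. (\<psi> has_derivative (\<lambda>h. f1 x * fst h + f2 x * snd h)) (at x)"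
    and c: "continuous_on UNIV f1" "continuous_on UNIV f2"
    unfolding C_k.simps by blast
  have c\<psi>: "continuous_on UNIV \<psi>" using \<open>C_k (Suc 0) \<psi>\<close> by (rule C_k_continuous)
  have 0: "\<psi> x = 0 \<and> f1 x = 0 \<and> f2 x = 0" if "x \<notin> ?S" for x
  proof -
    have van: "\<psi> y = 0" if "y \<in> - ?S" for y
      using closure_subset[of "{x. \<psi> x \<noteq> 0}"] that by auto
    have "((\<lambda>_. 0) has_derivative (\<lambda>_. 0)) (at x)" by simp
    moreover have "open (- ?S)" by (simp add: open_Compl)
    moreover have "x \<in> - ?S" using that unfolding Compl_iff .
    ultimately have "(\<psi> has_derivative (\<lambda>_. 0)) (at x)"
      by (rule has_derivative_transform_within_open) (erule van[symmetric])
    from has_derivative_unique[OF d this]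
    have "f1 x * fst h + f2 x * snd h = 0" for h by (rule fun_cong)
    from this[of "(1, 0)"] this[of "(0, 1)"] van[of x] that show ?thesis by auto
  qed
  have bd: "\<exists>B. \<forall>x. \<bar>f x\<bar> \<le> B" if "continuous_on UNIV f" "\<And>x. x \<notin> ?S \<Longrightarrow> f x = 0" for f :: "real \<times> real \<Rightarrow> real"
  proof -
    have "bounded (f ` ?S)"
      using that(1) S by (intro compact_imp_bounded compact_continuous_image) (auto intro: continuous_on_subset)
    then obtain B where "\<And>x. x \<in> ?S \<Longrightarrow> \<bar>f x\<bar> \<le> B" by (auto simp: bounded_real)
    then have "\<bar>f x\<bar> \<le> max B 0" for x using that(2)[of x] by (cases "x \<in> ?S") (auto simp: le_max_iff_disj)
    then show ?thesis by blast
  qed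
  obtain B0 where B0: "\<bar>\<psi> x\<bar> \<le> B0" for x using bd[OF c\<psi>] 0 by blast
  obtain B1 where B1: "\<bar>f1 x\<bar> \<le> B1" for x using bd[OF c(1)] 0 by blast
  obtain B2 where B2: "\<bar>f2 x\<bar> \<le> B2" for x using bd[OF c(2)] 0 by blast
  show ?thesis
  proof (rule that[OF d c c\<psi>])
    fix x
    show "\<bar>\<psi> x\<bar> \<le> max B0 (max B1 B2)" using B0[of x] by simp
    show "\<bar>f1 x\<bar> \<le> max B0 (max B1 B2)" using B1[of x] by simp
    show "\<bar>f2 x\<bar> \<le> max B0 (max B1 B2)" using B2[of x] by simp
  qed
qed

lemma frechet_derivative_coordinates:
  assumes "(f has_derivative (\<lambda>h. c * fst h + d * snd h)) (at (x :: real \<times> real))"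
  shows "frechet_derivative f (at x) (1, 0) = c" "frechet_derivative f (at x) (0, 1) = (d :: real)"
proof -
  have "c * fst h + d * snd h = frechet_derivative f (at x) h" for h
    by (rule fun_cong[OF frechet_derivative_at[OF assms]])
  from this[of "(1, 0)"] this[of "(0, 1)"]
  show "frechet_derivative f (at x) (1, 0) = c" "frechet_derivative f (at x) (0, 1) = d"
    unfolding fst_conv snd_conv by linarith+
qed

lemma test_function_mult_compose_fst:
  assumes \<psi>: "test_function V \<psi>" and U: "bounded U"
    and p: "\<And>y. (p has_real_derivative p' y) (at y)" and p': "\<And>k. C_k k (\<lambda>x. p' (fst x))"
    and m: "\<And>k. C_k k m"
    and pre: "\<And>y. (p (fst y), snd y) \<in> closure {x. \<psi> x \<noteq> 0} \<Longrightarrow> y \<in> U"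
  shows "test_function U (\<lambda>y. m y * \<psi> (p (fst y), snd y))" (is "test_function U ?f")
proof -
  let ?S = "closure {x. \<psi> x \<noteq> 0}" and ?X = "\<lambda>y. (p (fst y), snd y)"
  have "continuous_on UNIV p" by (intro continuous_at_imp_continuous_on ballI DERIV_isCont[OF p])
  then have "continuous_on UNIV (\<lambda>x. p (fst x))"
    by (rule continuous_on_compose2) (auto intro!: continuous_intros)
  then have "continuous_on UNIV ?X"
    by (intro continuous_on_Pair continuous_on_snd continuous_on_id)
  then have "closed (?X -` ?S)" by (rule closed_vimage[OF closed_closure])
  moreover have "{y. ?f y \<noteq> 0} \<subseteq> ?X -` ?S"
  proof
    fix y assume "y \<in> {y. ?f y \<noteq> 0}"
    then have "?f y \<noteq> 0" by (rule CollectD)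
    then have "\<psi> (?X y) \<noteq> 0" unfolding mult_eq_0_iff de_Morgan_disj by (rule conjunct2)
    then have "?X y \<in> {x. \<psi> x \<noteq> 0}" by (rule CollectI)
    then have "?X y \<in> ?S" by (rule subsetD[OF closure_subset])
    then show "y \<in> ?X -` ?S" by (rule vimageI2)
  qed
  ultimately have sub: "closure {y. ?f y \<noteq> 0} \<subseteq> ?X -` ?S" by (rule closure_minimal[rotated])
  also have "\<dots> \<subseteq> U" using pre by blast
  finally have U': "closure {y. ?f y \<noteq> 0} \<subseteq> U" .
  then have "compact (closure {y. ?f y \<noteq> 0})"
    unfolding compact_eq_bounded_closed using bounded_subset[OF U U'] by simp
  moreover have "C_k k \<psi>" for k using \<psi> unfolding test_function_def by blast
  then have "C_k k ?f" for k
    by (intro C_k_mult m C_k_compose_fst[OF p p'])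
  ultimately show ?thesis using U' unfolding test_function_def by blast
qed

section \<open>Sobolev functions and traces under a stretching\<close>

lemma weak_gradient_test:
  assumes "H1_with_gradient U u v" "test_function U \<phi>"
  shows "(LINT x:U|lborel. u x * frechet_derivative \<phi> (at x) (1, 0)) = - (LINT x:U|lborel. fst (v x) * \<phi> x)"
    and "(LINT x:U|lborel. u x * frechet_derivative \<phi> (at x) (0, 1)) = - (LINT x:U|lborel. snd (v x) * \<phi> x)"
  using assms unfolding H1_with_gradient_def by blast+

text \<open>
  The function \<open>\<psi> \<circ> stretch\<close> may be used in the weak formulation of \<open>u\<close> as if it were smooth. In
  the vertical direction the test function carries the slope as an additional factor: it
  compensates the Jacobian when the variables are changed afterwards.
\<close>

lemma weak_gradient_kinked_test:
  assumes u: "H1_with_gradient U u v" and U: "open U" "bounded U" and V: "open V"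
    and pre: "\<And>y. stretch a b s t y \<in> V \<Longrightarrow> y \<in> U"
    and \<psi>: "test_function V \<psi>"
  shows "(LINT y:U|lborel. u y * (slope a s t (fst y) * frechet_derivative \<psi> (at (stretch a b s t y)) (1, 0)))
           = - (LINT y:U|lborel. fst (v y) * \<psi> (stretch a b s t y))" (is ?Eq1)
    and "(LINT y:U|lborel. u y * (slope a s t (fst y) * frechet_derivative \<psi> (at (stretch a b s t y)) (0, 1)))
           = - (LINT y:U|lborel. snd (v y) * (slope a s t (fst y) * \<psi> (stretch a b s t y)))" (is ?Eq2)
proof -
  define e where "e j = 1 / real (Suc j)" for j
  have e: "e j > 0" "e \<longlonglongrightarrow> 0" for j
    using LIMSEQ_inverse_real_of_nat by (auto simp: e_def[abs_def] divide_inverse)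
  define X where "X j y = (smooth_kink (e j) a b s t (fst y), snd y)" for j and y :: "real \<times> real"
  define m where "m j y = smooth_slope (e j) a s t (fst y)" for j and y :: "real \<times> real"
  let ?X = "stretch a b s t" and ?m = "\<lambda>y :: real \<times> real. slope a s t (fst y)"
  obtain f1 f2 B where
    d\<psi>: "\<And>x. (\<psi> has_derivative (\<lambda>h. f1 x * fst h + f2 x * snd h)) (at x)" and
    cont: "continuous_on UNIV f1" "continuous_on UNIV f2" "continuous_on UNIV \<psi>" and
    B: "\<And>x. \<bar>\<psi> x\<bar> \<le> B" "\<And>x. \<bar>f1 x\<bar> \<le> B" "\<And>x. \<bar>f2 x\<bar> \<le> B"
    using test_function_gradient[OF \<psi>] by blast
  note D\<psi> = frechet_derivative_coordinates[OF d\<psi>]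

  let ?S = "closure {x. \<psi> x \<noteq> 0}"
  \<comment> \<open>The smoothed stretchings converge uniformly, so they eventually map no point outside \<open>U\<close> into
    the support of \<open>\<psi>\<close>, which has positive distance from the complement of \<open>V\<close>.\<close>
  have "compact ?S" "?S \<subseteq> V" using \<psi> by (auto simp: test_function_def)
  from compact_subset_open_imp_cball_epsilon_subset[OF this(1) V this(2)]
  obtain r where r: "r > 0" "(\<Union>x\<in>?S. cball x r) \<subseteq> V" .
  have "(\<lambda>j. \<bar>t - s\<bar> / 2 * e j) \<longlonglongrightarrow> \<bar>t - s\<bar> / 2 * 0" by (intro tendsto_intros e)
  then have "\<forall>\<^sub>F j in sequentially. \<bar>t - s\<bar> / 2 * e j < r" using r(1) by (intro order_tendstoD(2)) auto
  then have near: "\<forall>\<^sub>F j in sequentially. \<forall>y. X j y \<in> ?S \<longrightarrow> y \<in> U"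
  proof eventually_elim
    case (elim j)
    show ?case
    proof (intro allI impI)
      fix y assume y: "X j y \<in> ?S"
      have "dist (X j y) (?X y) \<le> r"
        using smooth_kink_close[OF e(1)[of j], of a b s t "fst y"] elim
        by (simp add: X_def stretch_def dist_Pair_Pair dist_real_def)
      then have "?X y \<in> (\<Union>x\<in>?S. cball x r)" by (intro UN_I[OF y]) (simp add: mem_cball)
      with r(2) have "?X y \<in> V" by (rule subsetD)
      then show "y \<in> U" by (rule pre)
    qed
  qed

  have dX: "((\<lambda>y. \<psi> (X j y)) has_derivative (\<lambda>h. m j y * f1 (X j y) * fst h + f2 (X j y) * snd h)) (at y)" for j y
    unfolding X_def m_def by (intro has_derivative_compose_fst smooth_kink_derivative e d\<psi>)
  have dmX: "frechet_derivative (\<lambda>y. m j y * \<psi> (X j y)) (at y) (0, 1) = m j y * f2 (X j y)" for j y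
  proof -
    have "C_k (Suc 0) (m j)" unfolding m_def[abs_def] by (rule C_k_smooth_slope[OF e(1)])
    then obtain g1 g2 where
      g: "\<And>y. (m j has_derivative (\<lambda>h. g1 y * fst h + g2 y * snd h)) (at y)"
      unfolding C_k.simps by blast
    \<comment> \<open>\<open>m j\<close> does not depend on the vertical variable; restricting it to a vertical line gives \<open>g2 y = 0\<close>.\<close>
    have "((\<lambda>_. smooth_slope (e j) a s t (fst y)) has_derivative (\<lambda>h. g2 y * h)) (at (snd y))"
      using has_derivative_compose[OF has_derivative_Pair[OF has_derivative_const[of "fst y" "at (snd y)"] has_derivative_ident], of "m j" "\<lambda>h. g1 y * fst h + g2 y * snd h"] g[of y]
      by (simp add: m_def[abs_def])
    from has_derivative_unique[OF this has_derivative_const]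
    have "g2 y * 1 = 0" by (rule fun_cong)
    then have g2: "g2 y = 0" by simp
    have "((\<lambda>y. m j y * \<psi> (X j y)) has_derivative
        (\<lambda>h. (g1 y * \<psi> (X j y) + m j y * (m j y * f1 (X j y))) * fst h + m j y * f2 (X j y) * snd h)) (at y)"
      by (rule has_derivative_eq_rhs[OF has_derivative_mult[OF g dX]]) (simp add: g2 algebra_simps)
    then show ?thesis by (rule frechet_derivative_coordinates)
  qed
  have test: "\<forall>\<^sub>F j in sequentially. test_function U (\<lambda>y. c j y * \<psi> (X j y))"
    if "\<And>j k. C_k k (c j)" for c
    using near
  proof eventually_elim
    case (elim j)
    then show ?case
      unfolding X_def
      by (intro test_function_mult_compose_fst[OF \<psi> U(2) smooth_kink_derivative[OF e(1)] C_k_smooth_slope[OF e(1)]] that)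
        blast
  qed
  have eq1: "\<forall>\<^sub>F j in sequentially.
      (LINT y:U|lborel. u y * (m j y * f1 (X j y))) = - (LINT y:U|lborel. fst (v y) * \<psi> (X j y))"
    using test[OF C_k_const[of _ 1]]
  proof eventually_elim
    case (elim j)
    then have "test_function U (\<lambda>y. \<psi> (X j y))" by simp
    from weak_gradient_test(1)[OF u this] show ?case
      unfolding frechet_derivative_coordinates(1)[OF dX] .
  qed
  have eq2: "\<forall>\<^sub>F j in sequentially.
      (LINT y:U|lborel. u y * (m j y * f2 (X j y))) = - (LINT y:U|lborel. snd (v y) * (m j y * \<psi> (X j y)))"
    using test[of m, unfolded m_def, OF C_k_smooth_slope[OF e(1)], folded m_def]
  proof eventually_elim
    case (elim j)
    from weak_gradient_test(2)[OF u this] show ?case unfolding dmX .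
  qed

  have contX: "continuous_on UNIV (X j)" for j
  proof -
    have "continuous_on UNIV (\<lambda>y :: real \<times> real. smooth_kink (e j) a b s t (fst y))"
      by (rule continuous_on_compose2[of UNIV])
        (auto intro!: continuous_intros continuous_at_imp_continuous_on DERIV_isCont smooth_kink_derivative e)
    then show ?thesis unfolding X_def[abs_def] by (intro continuous_intros)
  qed
  have limX: "(\<lambda>j. X j y) \<longlonglongrightarrow> ?X y" for y
    unfolding X_def stretch_def by (intro tendsto_intros smooth_kink_tendsto e)
  have limf: "(\<lambda>j. f (X j y)) \<longlonglongrightarrow> f (?X y)" if "continuous_on UNIV f" for f :: "real \<times> real \<Rightarrow> real" and y
    using that by (intro isCont_tendsto_compose[OF _ limX]) (simp add: continuous_on_eq_continuous_at del: split_paired_All)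
  \<comment> \<open>The slopes converge off the vertical line through the kink, which is a null set.\<close>
  have limm: "AE y in lborel. (\<lambda>j. m j y) \<longlonglongrightarrow> ?m y"
    using AE_fst_neq[of a] by eventually_elim (auto simp: m_def intro!: smooth_slope_tendsto e)
  have [measurable]: "(\<lambda>y. f (X j y)) \<in> borel_measurable borel" "(\<lambda>y. f (?X y)) \<in> borel_measurable borel"
    if "continuous_on UNIV f" for f :: "real \<times> real \<Rightarrow> real" and j
    using continuous_on_compose2[OF that contX, of j] continuous_on_compose2[OF that continuous_stretch]
    by (auto intro!: borel_measurable_continuous_onI)
  have [measurable]: "m j \<in> borel_measurable borel" for j
    unfolding m_def[abs_def]
    by (intro borel_measurable_continuous_onI C_k_continuous[of 0] C_k_smooth_slope e)
  note cont[measurable]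
  have m_bd: "\<bar>m j y\<bar> \<le> \<bar>s\<bar> + \<bar>t\<bar>" for j y unfolding m_def by (rule smooth_slope_bounded[OF e(1)])
  have int: "integrable lborel (\<lambda>y. indicator U y * w y)" if "L2_on U w" for w
    using U emeasure_bounded_finite[OF U(2)] by (intro L2_on_integrable[OF that]) auto
  have L2: "L2_on U u" "L2_on U (\<lambda>y. fst (v y))" "L2_on U (\<lambda>y. snd (v y))"
    using u unfolding H1_with_gradient_def by blast+
  have lim_m: "(\<lambda>j. LINT y:U|lborel. w y * (m j y * f (X j y))) \<longlonglongrightarrow> (LINT y:U|lborel. w y * (?m y * f (?X y)))"
    if "L2_on U w" "continuous_on UNIV f" "\<And>x. \<bar>f x\<bar> \<le> B" for w f
  proof -
    note that(2)[measurable]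
    have "(\<lambda>j. LINT y|lborel. indicator U y * w y * (m j y * f (X j y))) \<longlonglongrightarrow>
        (LINT y|lborel. indicator U y * w y * (?m y * f (?X y)))"
    proof (rule integral_bounded_factor_tendsto[OF int[OF that(1)], where B = "(\<bar>s\<bar> + \<bar>t\<bar>) * B"])
      show "\<bar>m j y * f (X j y)\<bar> \<le> (\<bar>s\<bar> + \<bar>t\<bar>) * B" for j y
        unfolding abs_mult using m_bd that(3) by (intro mult_mono) auto
      show "AE y in lborel. (\<lambda>j. m j y * f (X j y)) \<longlonglongrightarrow> ?m y * f (?X y)"
        using limm by eventually_elim (intro tendsto_intros limf that)
    qed measurable
    then show ?thesis by (simp add: set_lebesgue_integral_def mult.assoc)
  qed
  have lim_1: "(\<lambda>j. LINT y:U|lborel. w y * f (X j y)) \<longlonglongrightarrow> (LINT y:U|lborel. w y * f (?X y))"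
    if "L2_on U w" "continuous_on UNIV f" "\<And>x. \<bar>f x\<bar> \<le> B" for w f
  proof -
    note that(2)[measurable]
    have "(\<lambda>j. LINT y|lborel. indicator U y * w y * f (X j y)) \<longlonglongrightarrow>
        (LINT y|lborel. indicator U y * w y * f (?X y))"
      by (rule integral_bounded_factor_tendsto[OF int[OF that(1)], where B = B])
        (use that(3) limf[OF that(2)] in auto)
    then show ?thesis by (simp add: set_lebesgue_integral_def mult.assoc)
  qed
  show ?Eq1
    using tendsto_unique[OF _ lim_m[OF L2(1) cont(1) B(2)]
      Lim_transform_eventually[OF tendsto_minus[OF lim_1[OF L2(2) cont(3) B(1)]] eventually_mono[OF eq1 sym]]]
    by (simp add: D\<psi>)
  show ?Eq2
    using tendsto_unique[OF _ lim_m[OF L2(1) cont(2) B(3)]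
      Lim_transform_eventually[OF tendsto_minus[OF lim_m[OF L2(3) cont(3) B(1)]] eventually_mono[OF eq2 sym]]]
    by (simp add: D\<psi>)
qed

lemma stretch_inverse:
  assumes "s > 0" "t > 0"
  shows "stretch b a (1/s) (1/t) (stretch a b s t x) = x"
    and "stretch a b s t (stretch b a (1/s) (1/t) x) = x"
  using kink_inverse(1)[OF assms, of b a] kink_inverse(1)[of "1/s" "1/t" a b "fst x"] assms
  by (simp_all add: stretch_def)

lemma slope_bounds:
  assumes "s > 0" "t > 0"
  shows "0 < slope a s t x" "slope a s t x \<le> max s t"
  using assms by (auto simp: slope_def)

lemma L2_on_mult_bounded:
  fixes c :: "real \<times> real \<Rightarrow> real"
  assumes f: "L2_on U f" and [measurable]: "c \<in> borel_measurable borel" and B: "\<And>x. \<bar>c x\<bar> \<le> B"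
  shows "L2_on U (\<lambda>x. c x * f x)"
proof -
  have [measurable]: "(\<lambda>x. indicator U x * f x) \<in> borel_measurable borel"
    and i: "integrable lborel (\<lambda>x. indicator U x * (f x)\<^sup>2)"
    using f by (simp_all add: L2_on_def set_borel_measurable_def set_integrable_def)
  have m: "(\<lambda>x. c x * (indicator U x * f x)) \<in> borel_measurable borel" by measurable
  have "integrable lborel (\<lambda>x. B\<^sup>2 * (indicator U x * (f x)\<^sup>2))" using i by simp
  moreover have "(\<lambda>x. (c x)\<^sup>2 * (indicator U x * (f x)\<^sup>2)) \<in> borel_measurable lborel"
    using borel_measurable_integrable[OF i] by simp
  moreover have "norm ((c x)\<^sup>2 * (indicator U x * (f x)\<^sup>2)) \<le> norm (B\<^sup>2 * (indicator U x * (f x)\<^sup>2))" for x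
    using power_mono[OF B[of x], of 2]
    by (auto simp: abs_mult split: split_indicator intro!: mult_right_mono)
  ultimately have "integrable lborel (\<lambda>x. (c x)\<^sup>2 * (indicator U x * (f x)\<^sup>2))"
    by (rule Bochner_Integration.integrable_bound[OF _ _ AE_I2])
  with m show ?thesis
    by (simp add: L2_on_def set_borel_measurable_def set_integrable_def power_mult_distrib algebra_simps)
qed

lemma set_integral_stretch:
  assumes st: "s > 0" "t > 0" and pre: "\<And>x. stretch a b s t x \<in> U \<longleftrightarrow> x \<in> V"
    and [measurable]: "(\<lambda>y. indicator U y * f y) \<in> borel_measurable borel"
  shows "(LINT x:V|lborel. slope a s t (fst x) * f (stretch a b s t x)) = (LINT y:U|lborel. f y)"
    and "set_integrable lborel V (\<lambda>x. slope a s t (fst x) * f (stretch a b s t x)) \<longleftrightarrow> set_integrable lborel U f"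
proof -
  have eq: "indicator V x * (slope a s t (fst x) * f (stretch a b s t x)) =
      slope a s t (fst x) * (indicator U (stretch a b s t x) * f (stretch a b s t x))" for x
    using pre[of x] by (simp add: indicator_def)
  show "(LINT x:V|lborel. slope a s t (fst x) * f (stretch a b s t x)) = (LINT y:U|lborel. f y)"
    and "set_integrable lborel V (\<lambda>x. slope a s t (fst x) * f (stretch a b s t x)) \<longleftrightarrow> set_integrable lborel U f"
    using integral_stretch[OF st, of "\<lambda>y. indicator U y * f y" a b]
      integrable_stretch[OF st, of "\<lambda>y. indicator U y * f y" a b]
    unfolding set_lebesgue_integral_def set_integrable_def real_scaleR_def eq by simp_all
qed

lemma L2_on_stretch:
  assumes st: "s > 0" "t > 0" and pre: "\<And>x. stretch a b s t x \<in> U \<longleftrightarrow> x \<in> V"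
    and f: "L2_on U f"
  shows "L2_on V (\<lambda>x. f (stretch a b s t x))"
proof -
  let ?g = "\<lambda>x. f (stretch a b s t x)"
  have [measurable]: "(\<lambda>x. indicator U x * f x) \<in> borel_measurable borel"
    and i: "set_integrable lborel U (\<lambda>x. (f x)\<^sup>2)"
    using f by (simp_all add: L2_on_def set_borel_measurable_def)
  have "(\<lambda>x. indicator U x * (f x)\<^sup>2) = (\<lambda>x. (indicator U x * f x)\<^sup>2)"
    by (auto split: split_indicator)
  then have [measurable]: "(\<lambda>x. indicator U x * (f x)\<^sup>2) \<in> borel_measurable borel" by simp
  have eq: "indicator V x * ?g x = (\<lambda>x. indicator U x * f x) (stretch a b s t x)" for x
    using pre[of x] by (simp add: indicator_def)
  have m: "(\<lambda>x. indicator V x * ?g x) \<in> borel_measurable borel"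
    unfolding eq by (rule measurable_compose[OF stretch_measurable]) measurable
  have i: "integrable lborel (\<lambda>x. indicator V x * (slope a s t (fst x) * (?g x)\<^sup>2))"
    using set_integral_stretch(2)[OF st pre, of "\<lambda>x. (f x)\<^sup>2"] i by (simp add: set_integrable_def)
  have "integrable lborel (\<lambda>x. indicator V x * (?g x)\<^sup>2)"
  proof (rule Bochner_Integration.integrable_bound)
    show "integrable lborel (\<lambda>x. 1 / min s t * (indicator V x * (slope a s t (fst x) * (?g x)\<^sup>2)))"
      using i by simp
    have "(\<lambda>x. indicator V x * (?g x)\<^sup>2) = (\<lambda>x. (indicator V x * ?g x)\<^sup>2)"
      by (auto split: split_indicator)
    then show "(\<lambda>x. indicator V x * (?g x)\<^sup>2) \<in> borel_measurable lborel"
      using borel_measurable_power[OF m, of 2] by simp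
    have "z \<le> 1 / min s t * (slope a s t y * z)" if "z \<ge> 0" for y z
      using mult_right_mono[of 1 "slope a s t y / min s t" z] that st by (auto simp: slope_def field_simps)
    then show "AE x in lborel. norm (indicator V x * (?g x)\<^sup>2)
        \<le> norm (1 / min s t * (indicator V x * (slope a s t (fst x) * (?g x)\<^sup>2)))"
      using slope_bounds(1)[OF st, of a] st
      by (intro AE_I2) (auto split: split_indicator simp: abs_mult less_imp_le abs_of_pos)
  qed
  with m show ?thesis by (simp add: L2_on_def set_borel_measurable_def set_integrable_def)
qed

text \<open>
  Chain rule: test functions on \<open>V\<close> are carried to \<open>U\<close> by the inverse stretching, whose slope is the
  reciprocal of the Jacobian of the stretching.
\<close>

lemma H1_stretch:
  assumes st: "s > 0" "t > 0" and pre: "\<And>x. stretch a b s t x \<in> U \<longleftrightarrow> x \<in> V"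
    and U: "open U" "bounded U" and V: "open V"
    and u: "H1_with_gradient U u v"
  shows "H1_with_gradient V (\<lambda>x. u (stretch a b s t x))
     (\<lambda>x. (slope a s t (fst x) * fst (v (stretch a b s t x)), snd (v (stretch a b s t x))))"
proof -
  let ?F = "stretch a b s t" and ?G = "stretch b a (1/s) (1/t)"
  let ?m = "\<lambda>x. slope a s t (fst x)" and ?k = "\<lambda>y. slope b (1/s) (1/t) (fst y)"
  have L2: "L2_on U u" "L2_on U (\<lambda>y. fst (v y))" "L2_on U (\<lambda>y. snd (v y))"
    using u unfolding H1_with_gradient_def by blast+
  have mk: "?k (?F x) = 1 / ?m x" for x using kink_inverse(2)[OF st] by (simp add: stretch_def)
  have m0: "?m x > 0" for x by (rule slope_bounds(1)[OF st])
  have preG: "y \<in> U" if "?G y \<in> V" for y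
    using that pre[of "?G y"] stretch_inverse(2)[OF st, of a b y] by simp
  have meas: "(\<lambda>y. indicator U y * (w y * q y)) \<in> borel_measurable borel"
    if "L2_on U w" and [measurable]: "q \<in> borel_measurable borel" for w q :: "real \<times> real \<Rightarrow> real"
  proof -
    have [measurable]: "(\<lambda>y. indicator U y * w y) \<in> borel_measurable borel"
      using that by (simp add: L2_on_def set_borel_measurable_def)
    have "(\<lambda>y. indicator U y * w y * q y) \<in> borel_measurable borel" by measurable
    then show ?thesis by (simp add: mult.assoc)
  qed
  have [measurable]: "?G \<in> borel_measurable borel" by measurable
  have "(LINT x:V|lborel. u (?F x) * frechet_derivative \<psi> (at x) (1, 0)) =
        - (LINT x:V|lborel. ?m x * fst (v (?F x)) * \<psi> x) \<and>
        (LINT x:V|lborel. u (?F x) * frechet_derivative \<psi> (at x) (0, 1)) =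
        - (LINT x:V|lborel. snd (v (?F x)) * \<psi> x)"
    if \<psi>: "test_function V \<psi>" for \<psi>
  proof
    obtain f1 f2 B where d: "\<And>x. (\<psi> has_derivative (\<lambda>h. f1 x * fst h + f2 x * snd h)) (at x)"
      and c: "continuous_on UNIV f1" "continuous_on UNIV f2" "continuous_on UNIV \<psi>"
      and "\<And>x. \<bar>\<psi> x\<bar> \<le> B" "\<And>x. \<bar>f1 x\<bar> \<le> B" "\<And>x. \<bar>f2 x\<bar> \<le> B"
      using test_function_gradient[OF \<psi>] by blast
    note D = frechet_derivative_coordinates[OF d]
    have mG: "(\<lambda>y. f (?G y)) \<in> borel_measurable borel" "(\<lambda>y. ?k y * f (?G y)) \<in> borel_measurable borel"
      if "continuous_on UNIV f" for f :: "real \<times> real \<Rightarrow> real"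
    proof -
      show *: "(\<lambda>y. f (?G y)) \<in> borel_measurable borel"
        using continuous_on_compose2[OF that continuous_stretch] by (intro borel_measurable_continuous_onI) simp
      show "(\<lambda>y. ?k y * f (?G y)) \<in> borel_measurable borel"
        by (intro borel_measurable_times * slope_fst_measurable)
    qed
    note test = weak_gradient_kinked_test[OF u U V preG \<psi>, unfolded D]
    have change: "(LINT y:U|lborel. w y * q y) = (LINT x:V|lborel. w (?F x) * (?m x * q (?F x)))"
      if "L2_on U w" "q \<in> borel_measurable borel" for w q
      using set_integral_stretch(1)[OF st pre meas[OF that]] by (simp add: ac_simps)
    have inv: "?m x * (1 / ?m x * z) = z" for x z using m0[of x] by simp
    have "(LINT x:V|lborel. u (?F x) * f1 x) = (LINT y:U|lborel. u y * (?k y * f1 (?G y)))"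
      by (subst change[OF L2(1) mG(2)[OF c(1)]]) (simp only: mk inv stretch_inverse[OF st])
    also have "\<dots> = - (LINT y:U|lborel. fst (v y) * \<psi> (?G y))" by (rule test(1))
    also have "(LINT y:U|lborel. fst (v y) * \<psi> (?G y)) = (LINT x:V|lborel. ?m x * fst (v (?F x)) * \<psi> x)"
      by (subst change[OF L2(2) mG(1)[OF c(3)]]) (simp add: stretch_inverse[OF st] ac_simps)
    finally show "(LINT x:V|lborel. u (?F x) * frechet_derivative \<psi> (at x) (1, 0)) =
        - (LINT x:V|lborel. ?m x * fst (v (?F x)) * \<psi> x)" unfolding D .
    have "(LINT x:V|lborel. u (?F x) * f2 x) = (LINT y:U|lborel. u y * (?k y * f2 (?G y)))"
      by (subst change[OF L2(1) mG(2)[OF c(2)]]) (simp only: mk inv stretch_inverse[OF st])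
    also have "\<dots> = - (LINT y:U|lborel. snd (v y) * (?k y * \<psi> (?G y)))" by (rule test(2))
    also have "(LINT y:U|lborel. snd (v y) * (?k y * \<psi> (?G y))) = (LINT x:V|lborel. snd (v (?F x)) * \<psi> x)"
      by (subst change[OF L2(3) mG(2)[OF c(3)]]) (simp only: mk inv stretch_inverse[OF st])
    finally show "(LINT x:V|lborel. u (?F x) * frechet_derivative \<psi> (at x) (0, 1)) =
        - (LINT x:V|lborel. snd (v (?F x)) * \<psi> x)" unfolding D .
  qed
  moreover have "L2_on V (\<lambda>x. u (?F x))" "L2_on V (\<lambda>x. snd (v (?F x)))"
    by (rule L2_on_stretch[OF st pre L2(1)], rule L2_on_stretch[OF st pre L2(3)])
  moreover have "L2_on V (\<lambda>x. ?m x * fst (v (?F x)))"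
    using slope_bounds[OF st, of a]
    by (intro L2_on_mult_bounded[where B = "max s t"] L2_on_stretch[OF st pre L2(2)]) (auto simp: abs_of_pos)
  ultimately show ?thesis unfolding H1_with_gradient_def by simp
qed

lemma L2_on_measurable:
  assumes "L2_on U f"
  shows "(\<lambda>x. indicator U x * f x) \<in> borel_measurable borel"
  using assms by (simp add: L2_on_def set_borel_measurable_def)

lemma L2_on_cmult: "L2_on U f \<Longrightarrow> L2_on U (\<lambda>x. c * f x)" for f :: "'a::euclidean_space \<Rightarrow> real"
proof -
  assume f: "L2_on U f"
  have "(\<lambda>x. c * (indicator U x * f x)) \<in> borel_measurable borel"
    by (intro borel_measurable_times borel_measurable_const L2_on_measurable f)
  moreover have "integrable lborel (\<lambda>x. c\<^sup>2 * (indicator U x * (f x)\<^sup>2))"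
    using f by (simp add: L2_on_def set_integrable_def)
  ultimately show ?thesis
    by (simp add: L2_on_def set_borel_measurable_def set_integrable_def power_mult_distrib ac_simps)
qed

lemma L2_on_add:
  fixes f g :: "'a::euclidean_space \<Rightarrow> real"
  assumes f: "L2_on U f" and g: "L2_on U g"
  shows "L2_on U (\<lambda>x. f x + g x)"
proof -
  note [measurable] = L2_on_measurable[OF f] L2_on_measurable[OF g]
  have "(\<lambda>x. indicator U x * f x + indicator U x * g x) \<in> borel_measurable borel" by measurable
  then have m: "(\<lambda>x. indicator U x * (f x + g x)) \<in> borel_measurable borel" by (simp add: algebra_simps)
  have "integrable lborel (\<lambda>x. 2 * (indicator U x * (f x)\<^sup>2) + 2 * (indicator U x * (g x)\<^sup>2))"
    using f g by (simp add: L2_on_def set_integrable_def)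
  then have "integrable lborel (\<lambda>x. indicator U x * (f x + g x)\<^sup>2)"
  proof (rule Bochner_Integration.integrable_bound)
    have "(\<lambda>x. indicator U x * (f x + g x)\<^sup>2) = (\<lambda>x. (indicator U x * (f x + g x))\<^sup>2)"
      by (auto split: split_indicator)
    then show "(\<lambda>x. indicator U x * (f x + g x)\<^sup>2) \<in> borel_measurable lborel"
      using borel_measurable_power[OF m, of 2] by simp
    have "(y + z)\<^sup>2 \<le> 2 * y\<^sup>2 + 2 * z\<^sup>2" for y z :: real
      using sum_squares_ge_zero[of "y - z" 0] by (simp add: power2_eq_square algebra_simps)
    then show "AE x in lborel. norm (indicator U x * (f x + g x)\<^sup>2)
        \<le> norm (2 * (indicator U x * (f x)\<^sup>2) + 2 * (indicator U x * (g x)\<^sup>2))"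
      by (intro AE_I2) (simp split: split_indicator)
  qed
  with m show ?thesis by (simp add: L2_on_def set_borel_measurable_def set_integrable_def)
qed

lemma L2_on_diff:
  fixes f g :: "'a::euclidean_space \<Rightarrow> real"
  assumes "L2_on U f" "L2_on U g"
  shows "L2_on U (\<lambda>x. f x - g x)"
  using L2_on_add[OF assms(1) L2_on_cmult[OF assms(2), of "-1"]] by simp

lemma L2_on_power2_integrable: "L2_on U f \<Longrightarrow> set_integrable lborel U (\<lambda>x. (f x)\<^sup>2)"
  by (simp add: L2_on_def)

lemma L2_on_Int:
  fixes f :: "'a::euclidean_space \<Rightarrow> real"
  assumes "L2_on U f" "A \<in> sets borel"
  shows "L2_on (U \<inter> A) f"
proof -
  note [measurable] = L2_on_measurable[OF assms(1)] assms(2)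
  have "(\<lambda>x. indicator A x * (indicator U x * f x)) \<in> borel_measurable borel" by measurable
  moreover have "integrable lborel (\<lambda>x. indicator A x *\<^sub>R (indicator U x *\<^sub>R (f x)\<^sup>2))"
    using assms by (intro integrable_mult_indicator L2_on_power2_integrable[OF assms(1), unfolded set_integrable_def]) simp
  ultimately show ?thesis
    by (simp add: L2_on_def set_borel_measurable_def set_integrable_def indicator_inter_arith ac_simps)
qed

lemma norm_prod_power2: "(norm (p :: real \<times> real))\<^sup>2 = (fst p)\<^sup>2 + (snd p)\<^sup>2"
  by (cases p) (simp add: norm_Pair)

lemma H1_with_gradient_L2:
  assumes "H1_with_gradient U u v"
  shows "L2_on U u" "L2_on U (\<lambda>y. fst (v y))" "L2_on U (\<lambda>y. snd (v y))"
  using assms unfolding H1_with_gradient_def by blast+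

lemma H1_distance_integrable:
  assumes "H1_with_gradient U u v" "H1_with_gradient U w z"
  shows "set_integrable lborel U (\<lambda>x. (w x - u x)\<^sup>2 + (norm (z x - v x))\<^sup>2)"
  using L2_on_power2_integrable[OF L2_on_diff[OF H1_with_gradient_L2(1)[OF assms(2)] H1_with_gradient_L2(1)[OF assms(1)]]]
    L2_on_power2_integrable[OF L2_on_diff[OF H1_with_gradient_L2(2)[OF assms(2)] H1_with_gradient_L2(2)[OF assms(1)]]]
    L2_on_power2_integrable[OF L2_on_diff[OF H1_with_gradient_L2(3)[OF assms(2)] H1_with_gradient_L2(3)[OF assms(1)]]]
  by (simp add: norm_prod_power2 set_integral_add)

lemma set_integral_nonneg_real:
  "(\<And>x. 0 \<le> f x) \<Longrightarrow> 0 \<le> (LINT x:U|lborel. f x :: real)"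
  unfolding set_lebesgue_integral_def by (intro Bochner_Integration.integral_nonneg) auto

lemma squeeze_null:
  fixes f g :: "nat \<Rightarrow> real"
  assumes "\<And>k. 0 \<le> f k" "\<And>k. f k \<le> g k" "g \<longlonglongrightarrow> 0"
  shows "f \<longlonglongrightarrow> 0"
  using assms by (intro tendsto_sandwich[of "\<lambda>_. 0" f sequentially g 0]) (auto intro: always_eventually)

text \<open>
  Composition with the stretching is bounded on \<open>H\<^sup>1\<close> and leaves boundary values on a fixed vertical side
  alone, so it maps approximating sequences to approximating sequences.
\<close>

lemma has_trace_stretch:
  assumes st: "s > 0" "t > 0" and pre: "\<And>x. stretch a b s t x \<in> R \<longleftrightarrow> x \<in> R"
    and cl: "\<And>x. x \<in> closure R \<Longrightarrow> stretch a b s t x \<in> closure R"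
    and side: "kink a b s t c = c"
    and R: "open R" "bounded R" and tr: "has_trace R c J u h"
  shows "has_trace R c J (\<lambda>x. u (stretch a b s t x)) h"
proof -
  let ?F = "stretch a b s t" and ?m = "\<lambda>x. slope a s t (fst x)"
  let ?P = "\<lambda>v x. (?m x * fst (v (?F x)), snd (v (?F x)))"
  from tr obtain v w z where h: "L2_on J h" and u: "H1_with_gradient R u v"
    and w: "\<And>k::nat. H1_with_gradient R (w k) (z k)" "\<And>k::nat. continuous_on (closure R) (w k)"
    and lim: "(\<lambda>k. LINT x:R|lborel. (w k x - u x)\<^sup>2 + (norm (z k x - v x))\<^sup>2) \<longlonglongrightarrow> 0"
      "(\<lambda>k. LINT t:J|lborel. (w k (c, t) - h t)\<^sup>2) \<longlonglongrightarrow> 0"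
    unfolding has_trace_def by blast
  note pull = H1_stretch[OF st pre R R(1)]
  \<comment> \<open>The chain rule costs at most the factor \<open>1 + (max s t)\<^sup>2\<close>, and the Jacobian is at least \<open>min s t\<close>.\<close>
  define K where "K = (1 + (max s t)\<^sup>2) / min s t"
  have le: "(LINT x:R|lborel. (w k (?F x) - u (?F x))\<^sup>2 + (norm (?P (z k) x - ?P v x))\<^sup>2) \<le>
      K * (LINT x:R|lborel. (w k x - u x)\<^sup>2 + (norm (z k x - v x))\<^sup>2)" for k
  proof -
    let ?d = "\<lambda>x. (w k x - u x)\<^sup>2 + (norm (z k x - v x))\<^sup>2"
    have d: "set_integrable lborel R ?d" by (rule H1_distance_integrable[OF u w(1)])
    then have dm: "(\<lambda>x. indicator R x * ?d x) \<in> borel_measurable borel"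
      using borel_measurable_integrable[of lborel "\<lambda>x. indicator R x *\<^sub>R ?d x"] by (simp add: set_integrable_def)
    have le: "(LINT x:R|lborel. (w k (?F x) - u (?F x))\<^sup>2 + (norm (?P (z k) x - ?P v x))\<^sup>2) \<le>
        (LINT x:R|lborel. K * (?m x * ?d (?F x)))"
    proof (rule set_integral_mono)
      show "set_integrable lborel R (\<lambda>x. (w k (?F x) - u (?F x))\<^sup>2 + (norm (?P (z k) x - ?P v x))\<^sup>2)"
        by (rule H1_distance_integrable[OF pull[OF u] pull[OF w(1)]])
      show "set_integrable lborel R (\<lambda>x. K * (?m x * ?d (?F x)))"
        using set_integral_stretch(2)[OF st pre dm] d by simp
      fix x assume "x \<in> R"
      have m: "0 < ?m x" "?m x \<le> max s t" "min s t \<le> ?m x" using st by (auto simp: slope_def)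
      have "1 + (max s t)\<^sup>2 \<le> K * ?m x"
        using mult_left_mono[OF m(3), of "1 + (max s t)\<^sup>2"] st by (simp add: K_def pos_le_divide_eq)
      moreover have "(?m x)\<^sup>2 \<le> (max s t)\<^sup>2" using m by (intro power_mono) auto
      ultimately have K1: "1 \<le> K * ?m x" "(?m x)\<^sup>2 \<le> K * ?m x"
        using zero_le_power2[of "max s t"] by linarith+
      have "(w k (?F x) - u (?F x))\<^sup>2 + (norm (?P (z k) x - ?P v x))\<^sup>2 =
          1 * (w k (?F x) - u (?F x))\<^sup>2 + ((?m x)\<^sup>2 * (fst (z k (?F x)) - fst (v (?F x)))\<^sup>2
            + 1 * (snd (z k (?F x)) - snd (v (?F x)))\<^sup>2)"
        by (simp add: norm_prod_power2 power_mult_distrib[symmetric] right_diff_distrib)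
      also have "\<dots> \<le> K * ?m x * (w k (?F x) - u (?F x))\<^sup>2 + (K * ?m x * (fst (z k (?F x)) - fst (v (?F x)))\<^sup>2
            + K * ?m x * (snd (z k (?F x)) - snd (v (?F x)))\<^sup>2)"
        by (intro add_mono mult_right_mono K1 zero_le_power2)
      also have "\<dots> = K * (?m x * ?d (?F x))" by (simp add: norm_prod_power2 algebra_simps)
      finally show "(w k (?F x) - u (?F x))\<^sup>2 + (norm (?P (z k) x - ?P v x))\<^sup>2 \<le> K * (?m x * ?d (?F x))" .
    qed
    also have "\<dots> = K * (LINT x:R|lborel. ?d x)"
      using set_integral_stretch(1)[OF st pre dm] by simp
    finally show ?thesis .
  qed
  have "(\<lambda>k. K * (LINT x:R|lborel. (w k x - u x)\<^sup>2 + (norm (z k x - v x))\<^sup>2)) \<longlonglongrightarrow> 0"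
    using tendsto_mult_left[OF lim(1), of K] by simp
  then have "(\<lambda>k. LINT x:R|lborel. (w k (?F x) - u (?F x))\<^sup>2 + (norm (?P (z k) x - ?P v x))\<^sup>2) \<longlonglongrightarrow> 0"
    by (rule squeeze_null[OF _ le, rotated]) (simp add: set_integral_nonneg_real)
  moreover have "continuous_on (closure R) (\<lambda>x. w k (?F x))" for k
    using cl by (intro continuous_on_compose2[OF w(2) continuous_stretch]) auto
  moreover have "(\<lambda>k. LINT t:J|lborel. (w k (?F (c, t)) - h t)\<^sup>2) \<longlonglongrightarrow> 0"
    using lim(2) side by (simp add: stretch_def)
  ultimately show ?thesis
    unfolding has_trace_def using h pull[OF u] pull[OF w(1)]
    by (intro conjI exI[of _ "?P v"] exI[of _ "\<lambda>k x. w k (?F x)"] exI[of _ "\<lambda>k. ?P (z k)"] allI)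
qed

section \<open>Averages of competitors\<close>

lemma L2_on_mult_integrable:
  fixes f q :: "real \<times> real \<Rightarrow> real"
  assumes "L2_on U f" "open U" "bounded U" "q \<in> borel_measurable borel" "\<And>x. \<bar>q x\<bar> \<le> B"
  shows "set_integrable lborel U (\<lambda>x. f x * q x)"
  using L2_on_integrable[OF L2_on_mult_bounded[OF assms(1,4,5)]] emeasure_bounded_finite[OF assms(3)] assms(2)
  by (simp add: set_integrable_def ac_simps)

text \<open>
  Linearity of the weak gradient; the test function and its derivatives are bounded, so all the integrals
  that have to be added exist.
\<close>

lemma H1_average:
  assumes U: "open U" "bounded U" and u: "H1_with_gradient U u v" and u': "H1_with_gradient U u' v'"
  shows "H1_with_gradient U (\<lambda>x. 1/2 * (u x + u' x)) (\<lambda>x. (1/2) *\<^sub>R (v x + v' x))"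
proof -
  have "(LINT x:U|lborel. 1/2 * (u x + u' x) * frechet_derivative \<psi> (at x) (1, 0)) =
        - (LINT x:U|lborel. fst ((1/2) *\<^sub>R (v x + v' x)) * \<psi> x) \<and>
        (LINT x:U|lborel. 1/2 * (u x + u' x) * frechet_derivative \<psi> (at x) (0, 1)) =
        - (LINT x:U|lborel. snd ((1/2) *\<^sub>R (v x + v' x)) * \<psi> x)"
    if \<psi>: "test_function U \<psi>" for \<psi>
  proof -
    obtain f1 f2 B where d: "\<And>x. (\<psi> has_derivative (\<lambda>h. f1 x * fst h + f2 x * snd h)) (at x)"
      and c: "continuous_on UNIV f1" "continuous_on UNIV f2" "continuous_on UNIV \<psi>"
      and B: "\<And>x. \<bar>\<psi> x\<bar> \<le> B" "\<And>x. \<bar>f1 x\<bar> \<le> B" "\<And>x. \<bar>f2 x\<bar> \<le> B"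
      using test_function_gradient[OF \<psi>] by blast
    note D = frechet_derivative_coordinates[OF d]
    have avg: "(LINT x:U|lborel. 1/2 * (f x + f' x) * q x) = 1/2 * ((LINT x:U|lborel. f x * q x) + (LINT x:U|lborel. f' x * q x))"
      if "L2_on U f" "L2_on U f'" "continuous_on UNIV q" "\<And>x. \<bar>q x\<bar> \<le> B" for f f' q
    proof -
      have q: "q \<in> borel_measurable borel" using that(3) by (rule borel_measurable_continuous_onI)
      have eq: "1/2 * (f x + f' x) * q x = 1/2 * (f x * q x + f' x * q x)" for x
        by (simp add: field_simps)
      have "(LINT x:U|lborel. 1/2 * (f x + f' x) * q x) = 1/2 * ((LINT x:U|lborel. f x * q x) + (LINT x:U|lborel. f' x * q x))"
        unfolding eq by (subst set_integral_mult_right, subst set_integral_add)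
          (auto intro!: L2_on_mult_integrable that U q)
      then show ?thesis .
    qed
    note t = weak_gradient_test[OF u \<psi>, unfolded D] weak_gradient_test[OF u' \<psi>, unfolded D]
    have f: "fst ((1/2) *\<^sub>R (v x + v' x)) = 1/2 * (fst (v x) + fst (v' x))"
      "snd ((1/2) *\<^sub>R (v x + v' x)) = 1/2 * (snd (v x) + snd (v' x))" for x by simp_all
    show ?thesis
      unfolding D f avg[OF H1_with_gradient_L2(1)[OF u] H1_with_gradient_L2(1)[OF u'] c(1) B(2)] avg[OF H1_with_gradient_L2(1)[OF u] H1_with_gradient_L2(1)[OF u'] c(2) B(3)]
        avg[OF H1_with_gradient_L2(2)[OF u] H1_with_gradient_L2(2)[OF u'] c(3) B(1)] avg[OF H1_with_gradient_L2(3)[OF u] H1_with_gradient_L2(3)[OF u'] c(3) B(1)] t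
      by (simp only: mult_minus_right[symmetric] minus_add_distrib conj_absorb)
  qed
  moreover have "L2_on U (\<lambda>x. 1/2 * (u x + u' x))" "L2_on U (\<lambda>x. fst ((1/2) *\<^sub>R (v x + v' x)))"
    "L2_on U (\<lambda>x. snd ((1/2) *\<^sub>R (v x + v' x)))"
    using L2_on_cmult[OF L2_on_add[OF H1_with_gradient_L2(1)[OF u] H1_with_gradient_L2(1)[OF u']], of "1/2"]
      L2_on_cmult[OF L2_on_add[OF H1_with_gradient_L2(2)[OF u] H1_with_gradient_L2(2)[OF u']], of "1/2"]
      L2_on_cmult[OF L2_on_add[OF H1_with_gradient_L2(3)[OF u] H1_with_gradient_L2(3)[OF u']], of "1/2"] by simp_all
  ultimately show ?thesis unfolding H1_with_gradient_def by blast
qed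

lemma power2_average_le: "(1/2 * (x + y))\<^sup>2 \<le> 1/2 * x\<^sup>2 + 1/2 * (y :: real)\<^sup>2"
  using zero_le_power2[of "x - y"] by (simp add: power2_eq_square algebra_simps)

lemma continuous_L2_on:
  fixes f :: "'a::euclidean_space \<Rightarrow> real"
  assumes "open J" "bounded J" "continuous_on (closure J) f"
  shows "L2_on J f"
proof -
  have K: "compact (closure J)" using assms(2) by simp
  have m: "set_borel_measurable lborel J f"
    using assms borel_measurable_continuous_on_indicator[of J f] continuous_on_subset[OF assms(3) closure_subset]
    by (simp add: set_borel_measurable_def)
  have "set_integrable lborel (closure J) (\<lambda>x. (f x)\<^sup>2)"
    unfolding set_integrable_def using assms(3) by (intro borel_integrable_compact K continuous_intros)
  then have "set_integrable lborel J (\<lambda>x. (f x)\<^sup>2)"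
    by (rule set_integrable_subset) (use assms(1) closure_subset in auto)
  with m show ?thesis by (simp add: L2_on_def)
qed

lemma has_trace_average:
  assumes R: "open R" "bounded R" and J: "open J" "bounded J" "{c} \<times> closure J \<subseteq> closure R"
    and tr: "has_trace R c J u h" and tr': "has_trace R c J u' h"
  shows "has_trace R c J (\<lambda>x. 1/2 * (u x + u' x)) h"
proof -
  from tr obtain v w z where h: "L2_on J h" and u: "H1_with_gradient R u v"
    and w: "\<And>k::nat. H1_with_gradient R (w k) (z k)" "\<And>k::nat. continuous_on (closure R) (w k)"
    and lim: "(\<lambda>k. LINT x:R|lborel. (w k x - u x)\<^sup>2 + (norm (z k x - v x))\<^sup>2) \<longlonglongrightarrow> 0"
      "(\<lambda>k. LINT t:J|lborel. (w k (c, t) - h t)\<^sup>2) \<longlonglongrightarrow> 0"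
    unfolding has_trace_def by blast
  from tr' obtain v' w' z' where u': "H1_with_gradient R u' v'"
    and w': "\<And>k::nat. H1_with_gradient R (w' k) (z' k)" "\<And>k::nat. continuous_on (closure R) (w' k)"
    and lim': "(\<lambda>k. LINT x:R|lborel. (w' k x - u' x)\<^sup>2 + (norm (z' k x - v' x))\<^sup>2) \<longlonglongrightarrow> 0"
      "(\<lambda>k. LINT t:J|lborel. (w' k (c, t) - h t)\<^sup>2) \<longlonglongrightarrow> 0"
    unfolding has_trace_def by blast
  let ?a = "\<lambda>u u' x. 1/2 * (u x + u' x) :: real" and ?p = "\<lambda>v v' x. (1/2) *\<^sub>R (v x + v' x) :: real \<times> real"
  note avg = H1_average[OF R u u'] H1_average[OF R w(1) w'(1)]
  let ?d = "\<lambda>w u z v x. (w x - u x)\<^sup>2 + (norm (z x - v x :: real \<times> real))\<^sup>2 :: real"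
  have half: "(LINT x:U|lborel. 1/2 * f x + 1/2 * g x) = 1/2 * (LINT x:U|lborel. f x) + 1/2 * (LINT x:U|lborel. g x)"
    "set_integrable lborel U (\<lambda>x. 1/2 * f x + 1/2 * g x)"
    if "set_integrable lborel U f" "set_integrable lborel U g" for U f and g :: "'c::euclidean_space \<Rightarrow> real"
    using that by (simp_all add: set_integral_add)
  have d1: "?d (?a w0 w0') (?a u u') (?p z0 z0') (?p v v') x \<le> 1/2 * ?d w0 u z0 v x + 1/2 * ?d w0' u' z0' v' x"
    for w0 w0' z0 z0' x
    using power2_average_le[of "w0 x - u x" "w0' x - u' x"]
      power2_average_le[of "fst (z0 x) - fst (v x)" "fst (z0' x) - fst (v' x)"]
      power2_average_le[of "snd (z0 x) - snd (v x)" "snd (z0' x) - snd (v' x)"]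
    by (simp add: norm_prod_power2 algebra_simps)
  have "(LINT x:R|lborel. ?d (?a (w k) (w' k)) (?a u u') (?p (z k) (z' k)) (?p v v') x) \<le>
      1/2 * (LINT x:R|lborel. ?d (w k) u (z k) v x) + 1/2 * (LINT x:R|lborel. ?d (w' k) u' (z' k) v' x)" for k
    unfolding half(1)[OF H1_distance_integrable[OF u w(1)] H1_distance_integrable[OF u' w'(1)], symmetric]
    by (intro set_integral_mono H1_distance_integrable[OF avg(1) avg(2)]
        half(2) H1_distance_integrable[OF u w(1)] H1_distance_integrable[OF u' w'(1)] d1)
  moreover have "(\<lambda>k. 1/2 * (LINT x:R|lborel. ?d (w k) u (z k) v x) + 1/2 * (LINT x:R|lborel. ?d (w' k) u' (z' k) v' x)) \<longlonglongrightarrow> 0"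
    using tendsto_add[OF tendsto_mult_left[OF lim(1), of "1/2"] tendsto_mult_left[OF lim'(1), of "1/2"]] by simp
  ultimately have L1: "(\<lambda>k. LINT x:R|lborel. ?d (?a (w k) (w' k)) (?a u u') (?p (z k) (z' k)) (?p v v') x) \<longlonglongrightarrow> 0"
    by (rule squeeze_null[rotated]) (simp add: set_integral_nonneg_real)
  have side: "set_integrable lborel J (\<lambda>t. (w0 (c, t) - h t)\<^sup>2)" if "continuous_on (closure R) w0" for w0
  proof -
    have "continuous_on (closure J) (\<lambda>t. w0 (c, t))"
      using J(3) by (intro continuous_on_compose2[OF that]) (auto intro!: continuous_intros)
    from L2_on_power2_integrable[OF L2_on_diff[OF continuous_L2_on[OF J(1,2) this] h]] show ?thesis .
  qed
  have cont: "continuous_on (closure R) (?a (w k) (w' k))" for k by (intro continuous_intros w w')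
  have d2: "(?a w0 w0' (c, t) - h t)\<^sup>2 \<le> 1/2 * (w0 (c, t) - h t)\<^sup>2 + 1/2 * (w0' (c, t) - h t)\<^sup>2" for w0 w0' t
    using power2_average_le[of "w0 (c, t) - h t" "w0' (c, t) - h t"] by (simp add: algebra_simps)
  have "(LINT t:J|lborel. (?a (w k) (w' k) (c, t) - h t)\<^sup>2) \<le>
      1/2 * (LINT t:J|lborel. (w k (c, t) - h t)\<^sup>2) + 1/2 * (LINT t:J|lborel. (w' k (c, t) - h t)\<^sup>2)" for k
    unfolding half(1)[OF side[OF w(2)] side[OF w'(2)], symmetric]
    by (intro set_integral_mono side cont half(2) w w' d2)
  moreover have "(\<lambda>k. 1/2 * (LINT t:J|lborel. (w k (c, t) - h t)\<^sup>2) + 1/2 * (LINT t:J|lborel. (w' k (c, t) - h t)\<^sup>2)) \<longlonglongrightarrow> 0"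
    using tendsto_add[OF tendsto_mult_left[OF lim(2), of "1/2"] tendsto_mult_left[OF lim'(2), of "1/2"]] by simp
  ultimately have L2: "(\<lambda>k. LINT t:J|lborel. (?a (w k) (w' k) (c, t) - h t)\<^sup>2) \<longlonglongrightarrow> 0"
    by (rule squeeze_null[rotated]) (simp add: set_integral_nonneg_real)
  show ?thesis
    unfolding has_trace_def using h avg cont L1 L2
    by (intro conjI exI[of _ "?p v v'"] exI[of _ "\<lambda>k. ?a (w k) (w' k)"] exI[of _ "\<lambda>k. ?p (z k) (z' k)"] allI)
qed

text \<open>
  Minkowski's inequality. With \<open>p\<close> and \<open>q\<close> close to the norms of \<open>f\<close> and \<open>g\<close>, the weighted inequality
  \<open>(x + y)\<^sup>2 \<le> (p + q) (x\<^sup>2 / p + y\<^sup>2 / q)\<close> is nearly sharp after integration.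
\<close>

lemma L2_norm_average_le:
  fixes f g :: "'a::euclidean_space \<Rightarrow> real"
  assumes f: "L2_on U f" and g: "L2_on U g"
  shows "sqrt (LINT x:U|lborel. (1/2 * (f x + g x))\<^sup>2) \<le>
    (sqrt (LINT x:U|lborel. (f x)\<^sup>2) + sqrt (LINT x:U|lborel. (g x)\<^sup>2)) / 2"
proof -
  define A where "A = sqrt (LINT x:U|lborel. (f x)\<^sup>2)"
  define B where "B = sqrt (LINT x:U|lborel. (g x)\<^sup>2)"
  define X where "X = (LINT x:U|lborel. (f x + g x)\<^sup>2)"
  have A: "A \<ge> 0" "(LINT x:U|lborel. (f x)\<^sup>2) = A\<^sup>2" and B: "B \<ge> 0" "(LINT x:U|lborel. (g x)\<^sup>2) = B\<^sup>2"
    by (simp_all add: A_def B_def set_integral_nonneg_real)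
  note int = L2_on_power2_integrable[OF f] L2_on_power2_integrable[OF g]
    L2_on_power2_integrable[OF L2_on_add[OF f g]]
  have le: "X \<le> (A + B + 2 * e) * (A + B)" if e: "e > 0" for e
  proof -
    \<comment> \<open>The summand \<open>e\<close> keeps the weights positive when a norm vanishes; it is sent to \<open>0\<close> at the end.\<close>
    define p where "p = A + e"
    define q where "q = B + e"
    have pq: "p > 0" "q > 0" "A \<le> p" "B \<le> q" using A B e by (auto simp: p_def q_def)
    have young: "(x + y)\<^sup>2 \<le> (p + q) / p * x\<^sup>2 + (p + q) / q * y\<^sup>2" for x y
    proof -
      have "(p + q) / p * x\<^sup>2 + (p + q) / q * y\<^sup>2 - (x + y)\<^sup>2 = (q * x - p * y)\<^sup>2 / (p * q)"
        using pq by (simp add: power2_eq_square field_simps)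
      also have "\<dots> \<ge> 0" using pq by simp
      finally show ?thesis by simp
    qed
    have "X \<le> (LINT x:U|lborel. (p + q) / p * (f x)\<^sup>2 + (p + q) / q * (g x)\<^sup>2)"
      unfolding X_def by (rule set_integral_mono) (use int young in auto)
    also have "\<dots> = (p + q) / p * A\<^sup>2 + (p + q) / q * B\<^sup>2"
      using int A B by (subst set_integral_add) auto
    also have "\<dots> = (p + q) * (A * (A / p) + B * (B / q))"
      by (simp add: power2_eq_square algebra_simps)
    also have "\<dots> \<le> (p + q) * (A * 1 + B * 1)"
      using pq A B by (intro mult_left_mono add_mono) (auto simp: divide_le_eq_1)
    finally show ?thesis by (simp add: p_def q_def algebra_simps)
  qed
  have "X \<le> (A + B)\<^sup>2"
  proof (rule tendsto_lowerbound)
    show "((\<lambda>e. (A + B + 2 * e) * (A + B)) \<longlongrightarrow> (A + B)\<^sup>2) (at_right 0)"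
      by (auto intro!: tendsto_eq_intros simp: power2_eq_square)
    show "\<forall>\<^sub>F e in at_right 0. X \<le> (A + B + 2 * e) * (A + B)"
      using le by (auto simp: eventually_at_filter)
  qed simp
  then have "sqrt X \<le> A + B" using A B by (intro real_le_lsqrt) auto
  moreover have "(LINT x:U|lborel. (1/2 * (f x + g x))\<^sup>2) = 1/4 * X"
    unfolding X_def by (simp add: power_mult_distrib power_divide)
  then have "sqrt (LINT x:U|lborel. (1/2 * (f x + g x))\<^sup>2) = sqrt X / 2"
    by (simp only: real_sqrt_mult) (simp add: real_sqrt_divide)
  ultimately show ?thesis by (simp add: A_def B_def)
qed

text \<open>
  A function of the slope takes one value on each side of the kink and leaves the integrals there.
\<close>

lemma set_integral_slope:
  fixes p :: "real \<times> real \<Rightarrow> real"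
  assumes "L2_on D p"
  shows "(LINT x:D|lborel. k (slope a s t (fst x)) * (p x)\<^sup>2) =
      k s * (LINT x:D \<inter> {x. fst x \<le> a}|lborel. (p x)\<^sup>2) + k t * (LINT x:D \<inter> {x. a < fst x}|lborel. (p x)\<^sup>2)"
    and "set_integrable lborel D (\<lambda>x. k (slope a s t (fst x)) * (p x)\<^sup>2)"
proof -
  have i: "integrable lborel (\<lambda>x. indicator A x *\<^sub>R (indicator D x *\<^sub>R (p x)\<^sup>2))" if "A \<in> sets borel" for A
    using that by (intro integrable_mult_indicator L2_on_power2_integrable[OF assms, unfolded set_integrable_def]) simp
  have S: "{x :: real \<times> real. fst x \<le> a} \<in> sets borel" "{x :: real \<times> real. a < fst x} \<in> sets borel"
    by (auto intro!: borel_closed borel_open closed_Collect_le open_Collect_less continuous_intros)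
  have eq: "indicator D x *\<^sub>R (k (slope a s t (fst x)) * (p x)\<^sup>2) =
      k s * (indicator {x. fst x \<le> a} x *\<^sub>R (indicator D x *\<^sub>R (p x)\<^sup>2)) +
      k t * (indicator {x. a < fst x} x *\<^sub>R (indicator D x *\<^sub>R (p x)\<^sup>2))" for x
    by (auto simp: slope_def split: split_indicator)
  show "set_integrable lborel D (\<lambda>x. k (slope a s t (fst x)) * (p x)\<^sup>2)"
    unfolding set_integrable_def eq using i S by simp
  show "(LINT x:D|lborel. k (slope a s t (fst x)) * (p x)\<^sup>2) =
      k s * (LINT x:D \<inter> {x. fst x \<le> a}|lborel. (p x)\<^sup>2) + k t * (LINT x:D \<inter> {x. a < fst x}|lborel. (p x)\<^sup>2)"
    unfolding set_lebesgue_integral_def eq indicator_inter_arith scaleR_scaleR[symmetric]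
      mult.commute[of "indicator D _ :: real"]
    using i S by (subst Bochner_Integration.integral_add) auto
qed

section \<open>The elastic energy as a function of the crack length\<close>

text \<open>
  The stretching that fixes \<open>0\<close> and \<open>L\<close> and moves the crack tip from \<open>a\<close> to \<open>b\<close>.
\<close>

definition crack_stretch :: "real \<Rightarrow> real \<Rightarrow> real \<Rightarrow> real \<times> real \<Rightarrow> real \<times> real" where
  "crack_stretch L a b = stretch a b (b / a) ((L - b) / (L - a))"

lemma kink_crack_order:
  assumes a: "0 < a" "a < L" and b: "0 < b" "b < L"
  defines "\<kappa> \<equiv> kink a b (b / a) ((L - b) / (L - a))"
  shows "\<kappa> 0 = 0" "\<kappa> L = L" "0 < \<kappa> x \<longleftrightarrow> 0 < x" "0 \<le> \<kappa> x \<longleftrightarrow> 0 \<le> x" "\<kappa> x < L \<longleftrightarrow> x < L"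
    "\<kappa> x \<le> L \<longleftrightarrow> x \<le> L" "\<kappa> x \<le> b \<longleftrightarrow> x \<le> a"
proof -
  have s: "b / a > 0" "(L - b) / (L - a) > 0" using a b by simp_all
  have mono: "\<kappa> x < \<kappa> y" if "x < y" for x y
  proof -
    have "b / a * (x - a) < b / a * (y - a)" "(L - b) / (L - a) * (x - a) < (L - b) / (L - a) * (y - a)"
      using that s by (simp_all only: mult_less_cancel_left_pos)
    moreover have "b / a * (x - a) \<le> 0" if "x \<le> a" using that s(1) by (intro mult_nonneg_nonpos) auto
    moreover have "0 < (L - b) / (L - a) * (y - a)" if "y > a" using that s(2) by (intro mult_pos_pos) auto
    ultimately show ?thesis using that unfolding \<kappa>_def kink_def by (cases "x \<le> a"; cases "y \<le> a") auto
  qed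
  then have "strict_mono \<kappa>" by (rule strict_monoI)
  note less = strict_mono_less[OF this] and le = strict_mono_less_eq[OF this]
  show 0: "\<kappa> 0 = 0" and L: "\<kappa> L = L" using a b by (simp_all add: \<kappa>_def kink_def)
  have A: "\<kappa> a = b" by (simp add: \<kappa>_def kink_def)
  show "0 < \<kappa> x \<longleftrightarrow> 0 < x" "0 \<le> \<kappa> x \<longleftrightarrow> 0 \<le> x" "\<kappa> x < L \<longleftrightarrow> x < L"
    "\<kappa> x \<le> L \<longleftrightarrow> x \<le> L" "\<kappa> x \<le> b \<longleftrightarrow> x \<le> a"
    using less[of 0 x] le[of 0 x] less[of x L] le[of x L] le[of x a] 0 L A by simp_all
qed

lemma crack_stretch_inverse:
  assumes "0 < a" "a < L" "0 < b" "b < L"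
  shows "crack_stretch L b a (crack_stretch L a b x) = x"
  using stretch_inverse(1)[of "b / a" "(L - b) / (L - a)" b a x] assms by (simp add: crack_stretch_def)

lemma cracked_domain_open: "open (Omega L H - crack l)" and cracked_domain_bounded: "bounded (Omega L H - crack l)"
proof -
  have "closed (crack l)" by (simp add: crack_def closed_Times)
  then show "open (Omega L H - crack l)" by (auto simp: Omega_def intro!: open_Diff open_Times)
  show "bounded (Omega L H - crack l)"
    by (rule bounded_subset[of "Omega L H"]) (auto simp: Omega_def bounded_Times)
qed

lemma crack_stretch_domain:
  assumes "0 < a" "a < L" "0 < b" "b < L"
  shows "crack_stretch L a b x \<in> Omega L H - crack b \<longleftrightarrow> x \<in> Omega L H - crack a"
  using kink_crack_order[OF assms]
  by (cases x) (simp add: crack_stretch_def stretch_def Omega_def crack_def)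

lemma crack_stretch_rectangle:
  assumes "0 < a" "a < L" "0 < b" "b < L"
  shows "crack_stretch L a b x \<in> {0<..<L} \<times> J \<longleftrightarrow> x \<in> {0<..<L} \<times> J"
    and "crack_stretch L a b x \<in> {0..L} \<times> J \<longleftrightarrow> x \<in> {0..L} \<times> J"
  using kink_crack_order[OF assms] by (cases x; simp add: crack_stretch_def stretch_def)+

text \<open>
  The gradient of \<open>u \<circ> crack_stretch L a b\<close> when \<open>v\<close> is the gradient of \<open>u\<close>.
\<close>

definition pullback_gradient ::
    "real \<Rightarrow> real \<Rightarrow> real \<Rightarrow> (real \<times> real \<Rightarrow> real \<times> real) \<Rightarrow> real \<times> real \<Rightarrow> real \<times> real" where
  "pullback_gradient L a b v x =
     (slope a (b / a) ((L - b) / (L - a)) (fst x) * fst (v (crack_stretch L a b x)), snd (v (crack_stretch L a b x)))"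

lemma pullback_gradient_inverse:
  assumes "0 < a" "a < L" "0 < b" "b < L"
  shows "pullback_gradient L a b (pullback_gradient L b a v) = v"
proof
  fix x
  have "slope b (a / b) ((L - a) / (L - b)) (fst (crack_stretch L a b x)) =
      1 / slope a (b / a) ((L - b) / (L - a)) (fst x)"
    using kink_inverse(2)[of "b / a" "(L - b) / (L - a)" b a "fst x"] assms
    by (simp add: crack_stretch_def stretch_def)
  moreover have "slope a (b / a) ((L - b) / (L - a)) (fst x) \<noteq> 0"
    using assms by (simp add: slope_def)
  ultimately show "pullback_gradient L a b (pullback_gradient L b a v) x = v x"
    by (simp add: pullback_gradient_def crack_stretch_inverse[OF assms])
qed

lemma H1_crack_stretch:
  assumes "0 < a" "a < L" "0 < b" "b < L" and "H1_with_gradient (Omega L H - crack b) u v"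
  shows "H1_with_gradient (Omega L H - crack a) (\<lambda>x. u (crack_stretch L a b x)) (pullback_gradient L a b v)"
  unfolding pullback_gradient_def[abs_def] crack_stretch_def
  using assms crack_stretch_domain[OF assms(1-4), unfolded crack_stretch_def]
  by (intro H1_stretch[OF _ _ _ cracked_domain_open cracked_domain_bounded cracked_domain_open]) auto

lemma admissible_crack_stretch:
  assumes ab: "0 < a" "a < L" "0 < b" "b < L" and u: "u \<in> admissible L H g b"
  shows "(\<lambda>x. u (crack_stretch L a b x)) \<in> admissible L H g a"
proof -
  have tr: "has_trace ({0<..<L} \<times> {c<..<d}) e {c<..<d} (\<lambda>x. u (crack_stretch L a b x)) h"
    if "has_trace ({0<..<L} \<times> {c<..<d}) e {c<..<d} u h" "e \<in> {0, L}" for c d e h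
  proof -
    have cl: "closure ({0<..<L} \<times> {c<..<d}) = {0..L} \<times> closure {c<..<d}"
      using ab by (simp add: closure_Times)
    show ?thesis
      unfolding crack_stretch_def
      by (rule has_trace_stretch)
        (use ab that kink_crack_order[OF ab] crack_stretch_rectangle[OF ab, unfolded crack_stretch_def] in
          \<open>auto simp: cl bounded_Times intro!: open_Times\<close>)
  qed
  from u obtain v where "H1_with_gradient (Omega L H - crack b) u v" by (auto simp: admissible_def H1_def)
  from H1_crack_stretch[OF ab this] have "(\<lambda>x. u (crack_stretch L a b x)) \<in> H1 (Omega L H - crack a)"
    by (auto simp: H1_def)
  with u tr show ?thesis by (auto simp: admissible_def)
qed

lemma admissible_average:
  assumes "L > 0" "u \<in> admissible L H g a" "u' \<in> admissible L H g a"
  shows "(\<lambda>x. 1/2 * (u x + u' x)) \<in> admissible L H g a"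
proof -
  have tr: "has_trace ({0<..<L} \<times> {c<..<d}) e {c<..<d} (\<lambda>x. 1/2 * (u x + u' x)) h"
    if "has_trace ({0<..<L} \<times> {c<..<d}) e {c<..<d} u h" "has_trace ({0<..<L} \<times> {c<..<d}) e {c<..<d} u' h"
      "e \<in> {0, L}" for c d e h
    by (rule has_trace_average) (use assms(1) that in \<open>auto simp: closure_Times bounded_Times intro!: open_Times\<close>)
  obtain v v' where "H1_with_gradient (Omega L H - crack a) u v" "H1_with_gradient (Omega L H - crack a) u' v'"
    using assms by (auto simp: admissible_def H1_def)
  from H1_average[OF cracked_domain_open cracked_domain_bounded this]
  have "(\<lambda>x. 1/2 * (u x + u' x)) \<in> H1 (Omega L H - crack a)" by (auto simp: H1_def)
  with assms tr show ?thesis by (auto simp: admissible_def)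
qed

definition component :: "bool \<Rightarrow> real \<times> real \<Rightarrow> real" where
  "component c p = (if c then fst p else snd p)"

definition half_plane :: "bool \<Rightarrow> real \<Rightarrow> (real \<times> real) set" where
  "half_plane c a = (if c then {x. fst x \<le> a} else {x. a < fst x})"

text \<open>
  The four contributions to the energy are indexed by pairs: the first entry selects the horizontal
  (\<open>True\<close>) or vertical derivative, the second one the part of the domain to the left (\<open>True\<close>) or to the
  right of the crack tip.
\<close>

definition energy_part ::
    "real \<Rightarrow> real \<Rightarrow> real \<Rightarrow> real \<times> real \<Rightarrow> (real \<times> real \<Rightarrow> real \<times> real) \<Rightarrow> bool \<times> bool \<Rightarrow> real" where
  "energy_part L H a C v i = component (fst i) C / 2 *
     (LINT x:(Omega L H - crack a) \<inter> half_plane (snd i) a|lborel. (component (fst i) (v x))\<^sup>2)"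

definition side_ratio :: "real \<Rightarrow> real \<Rightarrow> bool \<Rightarrow> real \<Rightarrow> real" where
  "side_ratio L a c b = (if c then b / a else (L - b) / (L - a))"

text \<open>
  Pulling back multiplies the horizontal derivative by the slope. In terms of the pulled back gradient
  its square is therefore divided by the squared slope, and the Jacobian returns one power. For a
  vertical derivative only the Jacobian remains.
\<close>

definition weight :: "real \<Rightarrow> real \<Rightarrow> bool \<times> bool \<Rightarrow> real \<Rightarrow> real" where
  "weight L a i b = (if fst i then 1 / side_ratio L a (snd i) b else side_ratio L a (snd i) b)"

lemma sum_bool_pairs:
  fixes f :: "bool \<times> bool \<Rightarrow> real"
  shows "(\<Sum>i\<in>UNIV. f i) = f (True, True) + f (True, False) + f (False, True) + f (False, False)"
  unfolding UNIV_Times_UNIV[symmetric] sum.cartesian_product'[symmetric] by (simp add: UNIV_bool)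

text \<open>
  This separates the crack length from the competitor: once the competitor is pulled back to the
  reference length \<open>a\<close>, only the weights depend on \<open>b\<close>.
\<close>

lemma energy_stretched:
  assumes ab: "0 < a" "a < L" "0 < b" "b < L" and v: "H1_with_gradient (Omega L H - crack b) u v"
  shows "1/2 * (LINT x:(Omega L H - crack b)|lborel. fst C * (fst (v x))\<^sup>2 + snd C * (snd (v x))\<^sup>2) =
    (\<Sum>i\<in>UNIV. weight L a i b * energy_part L H a C (pullback_gradient L a b v) i)"
proof -
  let ?D = "\<lambda>l. Omega L H - crack l" and ?s = "b / a" and ?t = "(L - b) / (L - a)"
  let ?m = "\<lambda>x. slope a ?s ?t (fst x)" and ?P = "pullback_gradient L a b v"
  let ?F = "\<lambda>y. fst C * (fst (v y))\<^sup>2 + snd C * (snd (v y))\<^sup>2"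
  have st: "?s > 0" "?t > 0" using ab by simp_all
  note P = H1_crack_stretch[OF ab v]
  have "set_integrable lborel (?D b) ?F"
    using L2_on_power2_integrable[OF H1_with_gradient_L2(2)[OF v]] L2_on_power2_integrable[OF H1_with_gradient_L2(3)[OF v]]
    by (simp add: set_integral_add)
  from borel_measurable_integrable[OF this[unfolded set_integrable_def]]
  have meas: "(\<lambda>y. indicator (?D b) y * ?F y) \<in> borel_measurable borel" by simp
  have "(LINT x:?D b|lborel. ?F x) = (LINT x:?D a|lborel. ?m x * ?F (crack_stretch L a b x))"
    unfolding crack_stretch_def
    by (rule set_integral_stretch(1)[OF st _ meas, symmetric])
      (rule crack_stretch_domain[OF ab, unfolded crack_stretch_def])
  also have "\<dots> = (LINT x:?D a|lborel. fst C * (1 / ?m x) * (fst (?P x))\<^sup>2 + snd C * ?m x * (snd (?P x))\<^sup>2)"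
  proof -
    have "?m x \<noteq> 0" for x using slope_bounds(1)[OF st, of a "fst x"] by simp
    then have "?m x * ?F (crack_stretch L a b x) =
        fst C * (1 / ?m x) * (fst (?P x))\<^sup>2 + snd C * ?m x * (snd (?P x))\<^sup>2" for x
      by (simp add: pullback_gradient_def power2_eq_square field_simps)
    then show ?thesis by simp
  qed
  also have "\<dots> = (LINT x:?D a|lborel. fst C * (1 / ?m x) * (fst (?P x))\<^sup>2) +
      (LINT x:?D a|lborel. snd C * ?m x * (snd (?P x))\<^sup>2)"
    using set_integral_slope(2)[OF H1_with_gradient_L2(2)[OF P], of "\<lambda>r. fst C * (1 / r)"]
      set_integral_slope(2)[OF H1_with_gradient_L2(3)[OF P], of "\<lambda>r. snd C * r"]
    by (rule set_integral_add)
  also note set_integral_slope(1)[OF H1_with_gradient_L2(2)[OF P], of "\<lambda>r. fst C * (1 / r)"]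
  also note set_integral_slope(1)[OF H1_with_gradient_L2(3)[OF P], of "\<lambda>r. snd C * r"]
  finally have eq: "(LINT x:?D b|lborel. ?F x) = fst C * (1 / ?s) * (LINT x:?D a \<inter> {x. fst x \<le> a}|lborel. (fst (?P x))\<^sup>2)
      + fst C * (1 / ?t) * (LINT x:?D a \<inter> {x. a < fst x}|lborel. (fst (?P x))\<^sup>2)
      + (snd C * ?s * (LINT x:?D a \<inter> {x. fst x \<le> a}|lborel. (snd (?P x))\<^sup>2)
      + snd C * ?t * (LINT x:?D a \<inter> {x. a < fst x}|lborel. (snd (?P x))\<^sup>2))" .
  have alg: "1/2 * (p * r1 * i1 + p * r2 * i2 + (q * r3 * i3 + q * r4 * i4)) =
      r1 * (p / 2 * i1) + r2 * (p / 2 * i2) + r3 * (q / 2 * i3) + r4 * (q / 2 * i4)"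
    for p q r1 r2 r3 r4 i1 i2 i3 i4 :: real
    by (simp add: algebra_simps)
  show ?thesis
    unfolding eq alg sum_bool_pairs weight_def side_ratio_def energy_part_def component_def half_plane_def
      fst_conv snd_conv if_True if_False simp_thms ..
qed

definition admissible_pairs ::
    "real \<Rightarrow> real \<Rightarrow> (real \<times> real \<Rightarrow> real) \<Rightarrow> real \<Rightarrow> ((real \<times> real \<Rightarrow> real) \<times> (real \<times> real \<Rightarrow> real \<times> real)) set"
  where
  "admissible_pairs L H g l =
     {(u, v). u \<in> admissible L H g l \<and> H1_with_gradient (Omega L H - crack l) u v}"

lemma Collect_pair_image: "{f v | u v. u \<in> A \<and> P u v} = (\<lambda>p. f (snd p)) ` {(u, v). u \<in> A \<and> P u v}"
  by force

lemma elastic_energy_as_INF: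
  "elastic_energy L H g C l = (INF p\<in>admissible_pairs L H g l.
     1/2 * (LINT x:(Omega L H - crack l)|lborel. fst (C x) * (fst (snd p x))\<^sup>2 + snd (C x) * (snd (snd p x))\<^sup>2))"
  unfolding elastic_energy_def admissible_pairs_def Collect_pair_image ..

text \<open>
  Pulling back along the stretching is a bijection between the competitors for the two crack lengths, so
  the infimum can be taken over a set that does not depend on \<open>b\<close>.
\<close>

lemma elastic_energy_transported:
  assumes ab: "0 < a" "a < L" "0 < b" "b < L"
  shows "elastic_energy L H g (\<lambda>_. C) b =
    (INF p\<in>admissible_pairs L H g a. \<Sum>i\<in>UNIV. weight L a i b * energy_part L H a C (snd p) i)"
proof -
  let ?T = "\<lambda>a b p. (\<lambda>x. fst p (crack_stretch L a b x), pullback_gradient L a b (snd p))"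
  have T: "?T a b p \<in> admissible_pairs L H g a"
    if "p \<in> admissible_pairs L H g b" "0 < a" "a < L" "0 < b" "b < L" for a b p
    using that H1_crack_stretch[of a L b H "fst p" "snd p"] admissible_crack_stretch[of a L b "fst p" H g]
    by (auto simp: admissible_pairs_def)
  let ?E = "\<lambda>p. 1/2 * (LINT x:(Omega L H - crack b)|lborel. fst C * (fst (snd p x))\<^sup>2 + snd C * (snd (snd p x))\<^sup>2)"
  let ?Q = "\<lambda>p. \<Sum>i\<in>UNIV. weight L a i b * energy_part L H a C (snd p) i"
  have E: "?E p = ?Q (?T a b p)" if "p \<in> admissible_pairs L H g b" for p
    using that energy_stretched[OF ab, of H "fst p" "snd p" C] by (auto simp: admissible_pairs_def)
  have "?E ` admissible_pairs L H g b = ?Q ` admissible_pairs L H g a"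
  proof (intro equalityI subsetI)
    fix e assume "e \<in> ?E ` admissible_pairs L H g b"
    then obtain p where p: "p \<in> admissible_pairs L H g b" "e = ?E p" by blast
    from T[OF p(1) ab] show "e \<in> ?Q ` admissible_pairs L H g a"
      unfolding p(2) E[OF p(1)] by (rule imageI)
  next
    fix e assume "e \<in> ?Q ` admissible_pairs L H g a"
    then obtain p where p: "p \<in> admissible_pairs L H g a" "e = ?Q p" by blast
    have T': "?T b a p \<in> admissible_pairs L H g b" using T[OF p(1)] ab by blast
    have "?Q (?T a b (?T b a p)) = ?Q p" by (simp add: pullback_gradient_inverse[OF ab])
    with E[OF T'] p(2) have "e = ?E (?T b a p)" by simp
    with T' show "e \<in> ?E ` admissible_pairs L H g b" by blast
  qed
  then show ?thesis unfolding elastic_energy_as_INF by simp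
qed

lemma weight_positive: "0 < a \<Longrightarrow> a < L \<Longrightarrow> 0 < b \<Longrightarrow> b < L \<Longrightarrow> weight L a i b > 0"
  by (simp add: weight_def side_ratio_def)

lemma weight_derivative:
  assumes ab: "0 < a" "a < L"
  obtains w' where "\<And>i b. 0 < b \<Longrightarrow> b < L \<Longrightarrow> (weight L a i has_real_derivative w' i b) (at b)"
    "\<And>i. continuous_on {0<..<L} (w' i)"
proof
  define d where "d c = (if c then 1 / a else - 1 / (L - a))" for c
  let ?w' = "\<lambda>i b. if fst i then - d (snd i) / (side_ratio L a (snd i) b)\<^sup>2 else d (snd i)"
  have r: "(side_ratio L a c has_real_derivative d c) (at b)" for c b
  proof (cases c)
    case False
    have "((\<lambda>b. (L - b) / (L - a)) has_real_derivative (0 - 1) / (L - a)) (at b)"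
      by (intro DERIV_cdivide DERIV_diff DERIV_const DERIV_ident)
    with False show ?thesis by (simp add: side_ratio_def[abs_def] d_def)
  next
    case True
    have "((\<lambda>b. b / a) has_real_derivative 1 / a) (at b)"
      by (intro DERIV_cdivide DERIV_ident)
    with True show ?thesis by (simp add: side_ratio_def[abs_def] d_def)
  qed
  have r0: "side_ratio L a c b > 0" if "0 < b" "b < L" for c b using that ab by (simp add: side_ratio_def)
  show "(weight L a i has_real_derivative ?w' i b) (at b)" if "0 < b" "b < L" for i b
  proof (cases "fst i")
    case True
    have "((\<lambda>b. inverse (side_ratio L a (snd i) b)) has_real_derivative
        - (inverse (side_ratio L a (snd i) b) * d (snd i) * inverse (side_ratio L a (snd i) b))) (at b)"
      using r0[OF that, of "snd i"] by (intro DERIV_inverse' r) simp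
    then show ?thesis using True
      by (simp add: weight_def[abs_def] divide_inverse power2_eq_square ac_simps)
  qed (simp add: weight_def[abs_def] r)
  show "continuous_on {0<..<L} (?w' i)" for i
  proof (cases "fst i")
    case True
    have "continuous_on {0<..<L} (side_ratio L a (snd i))"
      by (intro continuous_at_imp_continuous_on ballI DERIV_isCont[OF r])
    moreover have "\<forall>b\<in>{0<..<L}. (side_ratio L a (snd i) b)\<^sup>2 \<noteq> 0" using r0[of _ "snd i"] by force
    ultimately show ?thesis using True by (simp add: continuous_intros)
  qed simp
qed

lemma energy_part_average:
  assumes C: "fst C > 0" "snd C > 0"
    and u: "H1_with_gradient (Omega L H - crack a) u v" and u': "H1_with_gradient (Omega L H - crack a) u' v'"
  shows "sqrt (energy_part L H a C (\<lambda>x. (1/2) *\<^sub>R (v x + v' x)) i) \<le>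
    (sqrt (energy_part L H a C v i) + sqrt (energy_part L H a C v' i)) / 2"
proof -
  let ?D = "(Omega L H - crack a) \<inter> half_plane (snd i) a" and ?c = "component (fst i)"
  have c: "?c C > 0" using C by (simp add: component_def)
  have B: "half_plane (snd i) a \<in> sets borel"
    by (auto simp: half_plane_def intro!: borel_closed borel_open closed_Collect_le open_Collect_less continuous_intros)
  have L2: "L2_on ?D (\<lambda>x. ?c (w x))" if "H1_with_gradient (Omega L H - crack a) q w" for q w
    using L2_on_Int[OF H1_with_gradient_L2(2)[OF that] B] L2_on_Int[OF H1_with_gradient_L2(3)[OF that] B] by (cases "fst i") (simp_all add: component_def)
  have avg: "?c ((1/2) *\<^sub>R (v x + v' x)) = 1/2 * (?c (v x) + ?c (v' x))" for x
    by (simp add: component_def)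
  have "sqrt (?c C / 2) * sqrt (LINT x:?D|lborel. (1/2 * (?c (v x) + ?c (v' x)))\<^sup>2) \<le>
      sqrt (?c C / 2) * ((sqrt (LINT x:?D|lborel. (?c (v x))\<^sup>2) + sqrt (LINT x:?D|lborel. (?c (v' x))\<^sup>2)) / 2)"
    using c by (intro mult_left_mono L2_norm_average_le L2[OF u] L2[OF u']) simp
  then show ?thesis unfolding energy_part_def avg real_sqrt_mult by (simp add: field_simps)
qed

text \<open>
  The vectors of square roots of the four parts satisfy the midpoint condition by Minkowski's inequality
  for averages of competitors, so the infimum is \<open>C\<^sup>1\<close>. If there is no competitor for one crack length,
  there is none for any, and the energy is a constant default value.
\<close>

theorem elastic_energy_C1:
  assumes L: "L > 0" and C: "fst C > 0" "snd C > 0"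
  obtains E' where "continuous_on {0<..<L} E'"
    "\<And>l. 0 < l \<Longrightarrow> l < L \<Longrightarrow> (elastic_energy L H g (\<lambda>_. C) has_real_derivative E' l) (at l)"
proof -
  define a where "a = L / 2"
  have a: "0 < a" "a < L" using L by (simp_all add: a_def)
  define S where "S = admissible_pairs L H g a"
  define \<rho> where "\<rho> p = (\<chi> i. sqrt (energy_part L H a C (snd p) i))"
    for p :: "(real \<times> real \<Rightarrow> real) \<times> (real \<times> real \<Rightarrow> real \<times> real)"
  let ?F = "\<lambda>l. INF p\<in>S. \<Sum>i\<in>UNIV. weight L a i l * (\<rho> p $ i)\<^sup>2"
  have part0: "0 \<le> energy_part L H a C v i" for v i
    using C by (simp add: energy_part_def component_def set_integral_nonneg_real)
  have E: "elastic_energy L H g (\<lambda>_. C) l = ?F l" if "l \<in> {0<..<L}" for l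
    using elastic_energy_transported[OF a, of l H g C] that part0 by (simp add: S_def \<rho>_def)
  have "\<exists>E'. continuous_on {0<..<L} E' \<and> (\<forall>l\<in>{0<..<L}. (?F has_real_derivative E' l) (at l))"
  proof (cases "S = {}")
    case True
    then show ?thesis by (intro exI[of _ "\<lambda>_. 0"]) simp
  next
    case False
    obtain w' where w': "\<And>i b. 0 < b \<Longrightarrow> b < L \<Longrightarrow> (weight L a i has_real_derivative w' i b) (at b)"
      "\<And>i. continuous_on {0<..<L} (w' i)"
      using weight_derivative[OF a] by blast
    have mid: "\<exists>r\<in>S. \<forall>i. \<rho> r $ i \<le> (\<rho> p $ i + \<rho> q $ i) / 2" if pq: "p \<in> S" "q \<in> S" for p q
    proof -
      obtain u v u' v' where p: "p = (u, v)" and q: "q = (u', v')" by (cases p, cases q) blast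
      have u: "u \<in> admissible L H g a" "H1_with_gradient (Omega L H - crack a) u v"
        and u': "u' \<in> admissible L H g a" "H1_with_gradient (Omega L H - crack a) u' v'"
        using pq by (auto simp: S_def p q admissible_pairs_def)
      let ?r = "(\<lambda>x. 1/2 * (u x + u' x), \<lambda>x. (1/2) *\<^sub>R (v x + v' x))"
      have "?r \<in> S"
        using admissible_average[OF L u(1) u'(1)] H1_average[OF cracked_domain_open cracked_domain_bounded u(2) u'(2)]
        by (simp add: S_def admissible_pairs_def)
      moreover have "\<rho> ?r $ i \<le> (\<rho> p $ i + \<rho> q $ i) / 2" for i
        using energy_part_average[OF C u(2) u'(2), of i] by (simp add: \<rho>_def p q)
      ultimately show ?thesis by blast
    qed
    show ?thesis
      by (rule infimum_of_weighted_energies_C1[OF False _ mid, of "{0<..<L}" "weight L a" w'])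
        (use w' a part0 in \<open>auto simp: \<rho>_def intro!: weight_positive\<close>)
  qed
  then obtain E' where E': "continuous_on {0<..<L} E'" "\<And>l. l \<in> {0<..<L} \<Longrightarrow> (?F has_real_derivative E' l) (at l)"
    by blast
  show ?thesis
  proof (rule that[OF E'(1)])
    fix l assume "0 < l" "l < L"
    then have l: "l \<in> {0<..<L}" by simp
    show "(elastic_energy L H g (\<lambda>_. C) has_real_derivative E' l) (at l)"
      by (rule has_field_derivative_transform_within_open[OF E'(2)[OF l] _ l]) (simp_all add: E)
  qed
qed

text \<open>
  Used to pass from a cracked domain to one with a longer crack; the two differ by a null set.
\<close>

lemma set_integral_AE_subset:
  fixes f :: "'a::euclidean_space \<Rightarrow> real"
  assumes "U \<subseteq> W" "AE x in lborel. x \<in> W \<longrightarrow> x \<in> U" and [measurable]: "U \<in> sets borel"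
    and [measurable]: "(\<lambda>x. indicator W x * f x) \<in> borel_measurable borel"
  shows "(LINT x:W|lborel. f x) = (LINT x:U|lborel. f x)"
proof -
  have "(\<lambda>x. indicator U x * (indicator W x * f x)) \<in> borel_measurable borel" by measurable
  moreover have "indicator U x * (indicator W x * f x) = indicator U x * f x" for x
    using assms(1) by (cases "x \<in> U") auto
  ultimately have "(\<lambda>x. indicator U x * f x) \<in> borel_measurable borel" by simp
  then show ?thesis
    using assms(1,2,4) unfolding set_lebesgue_integral_def real_scaleR_def
    by (intro integral_cong_AE) (auto elim!: AE_mp split: split_indicator)
qed

lemma H1_restrict_null:
  assumes UW: "U \<subseteq> W" "AE x in lborel. x \<in> W \<longrightarrow> x \<in> U" and U: "open U" and u: "H1_with_gradient W u v"
  shows "H1_with_gradient U u v"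
proof -
  have U': "U \<in> sets borel" "W \<inter> U = U" using U UW by auto
  have L2: "L2_on U f" if "L2_on W f" for f :: "real \<times> real \<Rightarrow> real"
    using L2_on_Int[OF that U'(1)] U'(2) by simp
  have "(LINT x:U|lborel. u x * frechet_derivative \<psi> (at x) (1, 0)) = - (LINT x:U|lborel. fst (v x) * \<psi> x) \<and>
      (LINT x:U|lborel. u x * frechet_derivative \<psi> (at x) (0, 1)) = - (LINT x:U|lborel. snd (v x) * \<psi> x)"
    if \<psi>: "test_function U \<psi>" for \<psi>
  proof -
    have \<psi>W: "test_function W \<psi>" using \<psi> UW by (auto simp: test_function_def)
    obtain f1 f2 B where d: "\<And>x. (\<psi> has_derivative (\<lambda>h. f1 x * fst h + f2 x * snd h)) (at x)"
      and c: "continuous_on UNIV f1" "continuous_on UNIV f2" "continuous_on UNIV \<psi>"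
      and B: "\<And>x. \<bar>\<psi> x\<bar> \<le> B" "\<And>x. \<bar>f1 x\<bar> \<le> B" "\<And>x. \<bar>f2 x\<bar> \<le> B"
      using test_function_gradient[OF \<psi>] by blast
    note D = frechet_derivative_coordinates[OF d]
    have restr: "(LINT x:W|lborel. f x * q x) = (LINT x:U|lborel. f x * q x)"
      if "L2_on W f" "continuous_on UNIV q" for f q
    proof (rule set_integral_AE_subset[OF UW U'(1)])
      have "(\<lambda>x. indicator W x * f x * q x) \<in> borel_measurable borel"
        by (intro borel_measurable_times L2_on_measurable that borel_measurable_continuous_onI)
      then show "(\<lambda>x. indicator W x * (f x * q x)) \<in> borel_measurable borel" by (simp only: mult.assoc)
    qed
    show ?thesis
      using weak_gradient_test[OF u \<psi>W] unfolding D
      by (simp only: restr[OF H1_with_gradient_L2(1)[OF u] c(1)] restr[OF H1_with_gradient_L2(1)[OF u] c(2)]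
          restr[OF H1_with_gradient_L2(2)[OF u] c(3)] restr[OF H1_with_gradient_L2(3)[OF u] c(3)])
  qed
  with L2[OF H1_with_gradient_L2(1)[OF u]] L2[OF H1_with_gradient_L2(2)[OF u]] L2[OF H1_with_gradient_L2(3)[OF u]] show ?thesis
    unfolding H1_with_gradient_def by blast
qed

lemma crack_growth:
  assumes "k \<le> l"
  shows "Omega L H - crack l \<subseteq> Omega L H - crack k"
    and "AE x in lborel. x \<in> Omega L H - crack k \<longrightarrow> x \<in> Omega L H - crack l"
proof -
  show "Omega L H - crack l \<subseteq> Omega L H - crack k" using assms by (auto simp: crack_def)
  show "AE x in lborel. x \<in> Omega L H - crack k \<longrightarrow> x \<in> Omega L H - crack l"
    using AE_snd_neq[of 0] by eventually_elim (auto simp: crack_def)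
qed

text \<open>
  A longer crack admits more competitors, and the energy of a competitor does not see the null set by which
  the domains differ. The two sets of competitors are empty together, so the default infimum of
  the empty set causes no jump.
\<close>

lemma elastic_energy_antimono:
  assumes kl: "0 < k" "k \<le> l" "l < L" and C: "fst C > 0" "snd C > 0"
  shows "elastic_energy L H g (\<lambda>_. C) l \<le> elastic_energy L H g (\<lambda>_. C) k"
proof -
  let ?A = "admissible_pairs L H g"
  let ?E = "\<lambda>l p. 1/2 * (LINT x:(Omega L H - crack l)|lborel. fst C * (fst (snd p x))\<^sup>2 + snd C * (snd (snd p x))\<^sup>2)"
  note grow = crack_growth[OF kl(2), of L H] and op = cracked_domain_open[of L H l]
  have sub: "?A k \<subseteq> ?A l"
    using H1_restrict_null[OF grow op] by (auto simp: admissible_pairs_def admissible_def H1_def)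
  have eq: "?E k p = ?E l p" if "p \<in> ?A k" for p
  proof -
    from that have "H1_with_gradient (Omega L H - crack k) (fst p) (snd p)" by (auto simp: admissible_pairs_def)
    note H1_with_gradient_L2[OF this]
    then have "set_integrable lborel (Omega L H - crack k) (\<lambda>x. fst C * (fst (snd p x))\<^sup>2 + snd C * (snd (snd p x))\<^sup>2)"
      by (simp add: set_integral_add L2_on_power2_integrable)
    from borel_measurable_integrable[OF this[unfolded set_integrable_def]] show ?thesis
      using op by (subst set_integral_AE_subset[OF grow]) auto
  qed
  show ?thesis
  proof (cases "?A k = {}")
    case True
    have "?A l = {}"
    proof (rule equals0I)
      fix p assume "p \<in> ?A l"
      then have "(\<lambda>x. fst p (crack_stretch L k l x), pullback_gradient L k l (snd p)) \<in> ?A k"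
        using kl H1_crack_stretch[of k L l H "fst p" "snd p"] admissible_crack_stretch[of k L l "fst p" H g]
        by (auto simp: admissible_pairs_def)
      with True show False by blast
    qed
    with True show ?thesis unfolding elastic_energy_as_INF by simp
  next
    case False
    have "?E k ` ?A k = ?E l ` ?A k" by (rule image_cong[OF refl eq])
    also have "\<dots> \<subseteq> ?E l ` ?A l" using sub by (rule image_mono)
    finally have "?E k ` ?A k \<subseteq> ?E l ` ?A l" .
    moreover have "bdd_below (?E l ` ?A l)"
      using C by (intro bdd_belowI[of _ 0]) (auto intro!: set_integral_nonneg_real)
    ultimately show ?thesis
      unfolding elastic_energy_as_INF using False by (intro cInf_superset_mono) auto
  qed
qed

lemma homogenized_release_properties:
  assumes "L > 0" "0 < lam" "lam < 1" "fst CA > 0" "snd CA > 0" "fst CB > 0" "snd CB > 0"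
  shows "continuous_on {0<..<L} (homogenized_release L H g lam CA CB)"
    and "0 < l \<Longrightarrow> l < L \<Longrightarrow> 0 \<le> homogenized_release L H g lam CA CB l"
proof -
  let ?C = "homogenized_stiffness lam CA CB" and ?G = "homogenized_release L H g lam CA CB"
  have C: "fst ?C > 0" "snd ?C > 0"
    using assms by (simp_all add: homogenized_stiffness_def add_pos_pos)
  obtain E' where E': "continuous_on {0<..<L} E'"
    "\<And>l. 0 < l \<Longrightarrow> l < L \<Longrightarrow> (elastic_energy L H g (\<lambda>_. ?C) has_real_derivative E' l) (at l)"
    using elastic_energy_C1[OF assms(1) C] by blast
  have G: "?G l = - E' l" if "0 < l" "l < L" for l
    using DERIV_imp_deriv[OF E'(2)[OF that]] by (simp add: homogenized_release_def homogenized_energy_def)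
  have "continuous_on {0<..<L} (\<lambda>l. - E' l)" by (intro continuous_intros E')
  then show "continuous_on {0<..<L} ?G" by (rule continuous_on_eq) (simp add: G)
  show "0 \<le> ?G l" if l: "0 < l" "l < L"
  proof (rule ccontr)
    assume "\<not> 0 \<le> ?G l"
    then have "E' l > 0" using G[OF l] by simp
    from DERIV_pos_inc_right[OF E'(2)[OF l] this] obtain d where d: "d > 0"
      "\<And>h. 0 < h \<Longrightarrow> h < d \<Longrightarrow> elastic_energy L H g (\<lambda>_. ?C) l < elastic_energy L H g (\<lambda>_. ?C) (l + h)"
      by blast
    \<comment> \<open>Small enough for the energy to increase strictly from \<open>l\<close> to \<open>l + h\<close>, with \<open>l + h\<close> below \<open>L\<close>.\<close>
    define h where "h = min d (L - l) / 2"
    have "0 < h" "h \<le> d / 2" "h \<le> (L - l) / 2" using d(1) l by (simp_all add: h_def)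
    then have "0 < h" "h < d" "l + h < L" using d(1) l(2) by (simp_all add: field_simps)
    with d(2)[of h] elastic_energy_antimono[OF l(1) _ _ C, of "l + h" L H g] show False by simp
  qed
qed

section \<open>The effective toughness\<close>

text \<open>
  Continuous convergence: the values are eventually finite, and continuity of the limit absorbs the
  variation of the evaluation point.
\<close>

lemma locally_uniformly_tendsto_sequence:
  assumes F: "locally_uniformly_tendsto S F f" and f: "continuous_on S f" and S: "open S"
    and l: "l \<in> S" and s: "s \<longlonglongrightarrow> l"
  obtains r where "r \<longlonglongrightarrow> f l" "\<forall>\<^sub>F n in sequentially. F n (s n) = ereal (r n)"
proof -
  obtain e where e: "e > 0" "cball l e \<subseteq> S" using S l open_contains_cball by blast
  have "\<forall>\<^sub>F n in sequentially. dist (s n) l < e" using s e(1) by (rule tendstoD)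
  then have K: "\<forall>\<^sub>F n in sequentially. s n \<in> cball l e"
    by eventually_elim (simp add: dist_commute less_imp_le)
  have close: "\<forall>\<^sub>F n in sequentially. \<bar>F n (s n) - ereal (f (s n))\<bar> < ereal \<epsilon>" if "\<epsilon> > 0" for \<epsilon>
  proof -
    have "\<forall>\<^sub>F n in sequentially. \<forall>x\<in>cball l e. \<bar>F n x - ereal (f x)\<bar> < ereal \<epsilon>"
      using F e(2) that compact_cball unfolding locally_uniformly_tendsto_def by blast
    with K show ?thesis by eventually_elim blast
  qed
  have real: "x = ereal (real_of_ereal x) \<and> \<bar>real_of_ereal x - y\<bar> < \<epsilon>" if "\<bar>x - ereal y\<bar> < ereal \<epsilon>" for x y \<epsilon>
    using that by (cases x) auto
  let ?r = "\<lambda>n. real_of_ereal (F n (s n))"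
  have "(\<lambda>n. ?r n - f (s n)) \<longlonglongrightarrow> 0"
  proof (rule tendstoI)
    fix \<epsilon> :: real assume "\<epsilon> > 0"
    from close[OF this] show "\<forall>\<^sub>F n in sequentially. dist (?r n - f (s n)) 0 < \<epsilon>"
      by eventually_elim (use real in \<open>simp add: dist_real_def\<close>)
  qed
  moreover have "(\<lambda>n. f (s n)) \<longlonglongrightarrow> f l"
    using f S l s by (metis continuous_on_eq_continuous_at isCont_tendsto_compose)
  ultimately have "(\<lambda>n. (?r n - f (s n)) + f (s n)) \<longlonglongrightarrow> 0 + f l" by (rule tendsto_add)
  then have "?r \<longlonglongrightarrow> f l" by simp
  moreover have "\<forall>\<^sub>F n in sequentially. F n (s n) = ereal (?r n)"
    using close[OF zero_less_one] by eventually_elim (use real in blast)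
  ultimately show ?thesis by (rule that)
qed

text \<open>
  The left end point of a layer belongs to it, so the tougher material can be sampled exactly at
  interfaces.
\<close>

lemma toughness_at_layer_point:
  assumes L: "L > 0" and k: "k < n" and lam: "0 < lam" "lam < 1"
  shows "layered_toughness L lam A B n (layer_point L n (real k)) = A"
    and "layered_toughness L lam A B n (layer_point L n (real k + lam)) = B"
proof -
  have c: "L / real n > 0" using L k by simp
  have pt: "layer_point L n x = x * (L / real n)" for x by (simp add: layer_point_def)
  have ord: "layer_point L n x \<le> layer_point L n y \<longleftrightarrow> x \<le> y" "layer_point L n x < layer_point L n y \<longleftrightarrow> x < y" for x y
    unfolding pt using c by (simp_all only: mult_le_cancel_right_pos mult_less_cancel_right_pos)
  have L': "L = layer_point L n (real n)" using k by (simp add: layer_point_def)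
  show "layered_toughness L lam A B n (layer_point L n (real k)) = A"
    using k lam unfolding layered_toughness_def ord by auto
  have "layer_point L n (real k + lam) < layer_point L n (real n)"
    unfolding ord using k lam by (simp add: less_le_trans[of _ "real k + 1"])
  then have "layer_point L n (real k + lam) \<noteq> L" using L' by simp
  moreover have "\<not> (\<exists>k'<n. real k' \<le> real k + lam \<and> real k + lam < real k' + lam)" using lam by auto
  ultimately show "layered_toughness L lam A B n (layer_point L n (real k + lam)) = B"
    unfolding layered_toughness_def ord by (intro if_not_P) blast
qed

text \<open>
  Both kinds of interface occur in each of the \<open>n\<close> periods of length \<open>L / n\<close>; the right kind is chosen in the
  period containing \<open>l\<close>.
\<close>

lemma recovery_sequence:
  assumes L: "L > 0" and l: "0 < l" "l < L" and lam: "0 < lam" "lam < 1"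
  obtains s where "\<And>n. s n \<in> {0..L}" "s \<longlonglongrightarrow> l"
    "\<forall>\<^sub>F n in sequentially. layered_toughness L lam A B n (s n) = max A B"
proof -
  \<comment> \<open>Relative position, within a period, of the left end of the layer with the larger toughness.\<close>
  define \<theta> where "\<theta> = (if A \<ge> B then 0 else lam)"
  have \<theta>: "0 \<le> \<theta>" "\<theta> < 1" using lam by (auto simp: \<theta>_def)
  define k where "k n = nat \<lfloor>l * real n / L\<rfloor>" for n
  define s where "s n = layer_point L n (real (k n) + \<theta>)" for n
  have k: "real (k n) \<le> l * real n / L" "l * real n / L < real (k n) + 1" for n
    using L l by (auto simp: k_def)
  have kn: "k n < n" if "n > 0" for n
  proof -
    have "l * real n / L < real n" using L l that by (simp add: field_simps)
    with k(1)[of n] show ?thesis by linarith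
  qed
  have near: "\<bar>s n - l\<bar> \<le> L / real n" if "n > 0" for n
  proof -
    have "\<bar>(real (k n) + \<theta>) - l * real n / L\<bar> \<le> 1" using k[of n] \<theta> by linarith
    then have "\<bar>(real (k n) + \<theta>) - l * real n / L\<bar> * (L / real n) \<le> 1 * (L / real n)"
      using L by (intro mult_right_mono) auto
    also have "\<bar>(real (k n) + \<theta>) - l * real n / L\<bar> * (L / real n) =
        \<bar>((real (k n) + \<theta>) - l * real n / L) * (L / real n)\<bar>"
      using L by (simp add: abs_mult)
    also have "((real (k n) + \<theta>) - l * real n / L) * (L / real n) = s n - l"
      using L that by (simp add: s_def layer_point_def field_simps)
    finally show ?thesis by simp
  qed
  show ?thesis
  proof (rule that)
    fix n
    have "(real (k n) + \<theta>) * L \<le> real n * L" if "n > 0"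
      using kn[OF that] \<theta> L by (intro mult_right_mono) auto
    then show "s n \<in> {0..L}"
      using L \<theta> by (cases "n = 0") (auto simp: s_def layer_point_def field_simps)
  next
    have "(\<lambda>n. L / real n) \<longlonglongrightarrow> 0" by (rule lim_const_over_n)
    then have "(\<lambda>n. s n - l) \<longlonglongrightarrow> 0"
      by (rule Lim_null_comparison[rotated]) (auto intro!: eventually_mono[OF eventually_gt_at_top[of 0]] near)
    then show "s \<longlonglongrightarrow> l" by (simp add: LIM_zero_iff)
  next
    show "\<forall>\<^sub>F n in sequentially. layered_toughness L lam A B n (s n) = max A B"
      using eventually_gt_at_top[of 0]
    proof eventually_elim
      case (elim n)
      note T = toughness_at_layer_point[OF L kn[OF elim] lam, of A B]
      show ?case
      proof (cases "A \<ge> B")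
        case True
        then show ?thesis using T(1) by (simp add: s_def \<theta>_def max_absorb1)
      next
        case False
        then show ?thesis using T(2) by (simp add: s_def \<theta>_def max_absorb2)
      qed
    qed
  qed
qed

theorem corollary1p21:
  fixes L H lam GcA GcB l :: real
    and CA CB :: "real \<times> real"
    and g :: "real \<times> real \<Rightarrow> real"
  assumes "L > 0" and "H > 0"
    and "0 < lam" and "lam < 1"
    and "fst CA > 0" and "snd CA > 0" and "fst CB > 0" and "snd CB > 0"
    and "GcA > 0" and "GcB > 0"
    and "boundary_datum L H g"
    and "locally_uniformly_tendsto {0<..<L}
           (layered_release L H g lam CA CB) (homogenized_release L H g lam CA CB)"
    and "l \<in> {0<..<L}"
    and "homogenized_release L H g lam CA CB l \<noteq> 0"
  shows "effective_toughness L H g lam CA CB GcA GcB l = ereal (max GcA GcB)"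
proof -
  let ?F = "layered_release L H g lam CA CB" and ?G = "homogenized_release L H g lam CA CB"
  let ?T = "layered_toughness L lam GcA GcB"
  define M where "M = max GcA GcB"
  let ?Q = "\<lambda>n s. ?F n s / ereal (?T n s)"
  have l: "0 < l" "l < L" using assms by auto
  note G = homogenized_release_properties[OF assms(1,3-8), where H = H and g = g]
  have Gpos: "?G l > 0" using G(2)[OF l] assms(14) by simp
  have M: "M > 0" using assms by (simp add: M_def)
  have T: "0 < ?T n s" "?T n s \<le> M" for n s using assms by (auto simp: layered_toughness_def M_def)
  have limit: "\<exists>r. r \<longlonglongrightarrow> ?G l \<and> (\<forall>\<^sub>F n in sequentially. ?F n (s n) = ereal (r n))" if "s \<longlonglongrightarrow> l" for s
    by (rule locally_uniformly_tendsto_sequence[OF assms(12) G(1) _ assms(13) that]) auto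
  have lower: "ereal (?G l / M) \<le> liminf (\<lambda>n. ?Q n (s n))" if s: "s \<longlonglongrightarrow> l" for s
  proof -
    obtain r where r: "r \<longlonglongrightarrow> ?G l" "\<forall>\<^sub>F n in sequentially. ?F n (s n) = ereal (r n)"
      using limit[OF s] by blast
    have "(\<lambda>n. ereal (r n / M)) \<longlonglongrightarrow> ereal (?G l / M)" using M by (intro tendsto_intros r) auto
    then have "ereal (?G l / M) = liminf (\<lambda>n. ereal (r n / M))"
      by (intro lim_imp_Liminf[symmetric]) auto
    also have "\<dots> \<le> liminf (\<lambda>n. ?Q n (s n))"
    proof (rule Liminf_mono)
      have "\<forall>\<^sub>F n in sequentially. r n > 0" by (rule order_tendstoD(1)[OF r(1) Gpos])
      with r(2) show "\<forall>\<^sub>F n in sequentially. ereal (r n / M) \<le> ?Q n (s n)"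
      proof eventually_elim
        case (elim n)
        have "r n / M \<le> r n / ?T n (s n)" using elim T[of n "s n"] by (intro divide_left_mono mult_pos_pos M) auto
        with elim T(1)[of n "s n"] show ?case by simp
      qed
    qed
    finally show ?thesis .
  qed
  obtain s where s: "\<And>n. s n \<in> {0..L}" "s \<longlonglongrightarrow> l" "\<forall>\<^sub>F n in sequentially. ?T n (s n) = M"
    unfolding M_def using recovery_sequence[OF assms(1) l assms(3,4)] by blast
  obtain r where r: "r \<longlonglongrightarrow> ?G l" "\<forall>\<^sub>F n in sequentially. ?F n (s n) = ereal (r n)"
    using limit[OF s(2)] by blast
  have "(\<lambda>n. ereal (r n / M)) \<longlonglongrightarrow> ereal (?G l / M)" using M by (intro tendsto_intros r) auto
  moreover from r(2) s(3) have "\<forall>\<^sub>F n in sequentially. ereal (r n / M) = ?Q n (s n)"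
    by eventually_elim (use M in simp)
  ultimately have "(\<lambda>n. ?Q n (s n)) \<longlonglongrightarrow> ereal (?G l / M)" by (rule Lim_transform_eventually)
  then have attained: "liminf (\<lambda>n. ?Q n (s n)) = ereal (?G l / M)" by (intro lim_imp_Liminf) auto
  have "release_toughness_liminf L H g lam CA CB GcA GcB l = ereal (?G l / M)"
    unfolding release_toughness_liminf_def Gamma_liminf_def
  proof (rule antisym)
    show "(INF s\<in>{s. (\<forall>n. s n \<in> {0..L}) \<and> s \<longlonglongrightarrow> l}. liminf (\<lambda>n. ?Q n (s n))) \<le> ereal (?G l / M)"
      unfolding attained[symmetric] using s by (intro INF_lower) auto
    show "ereal (?G l / M) \<le> (INF s\<in>{s. (\<forall>n. s n \<in> {0..L}) \<and> s \<longlonglongrightarrow> l}. liminf (\<lambda>n. ?Q n (s n)))"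
      using lower by (intro INF_greatest) auto
  qed
  then show ?thesis
    using Gpos M by (simp add: effective_toughness_def zero_ereal_def M_def[symmetric] del: ereal_max)
qed

end
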